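(* Let $k \in \mathbb{N}$ with $k\ge 2$. The space $\mathcal{H}^k$ is an algebra: there is a constant $C>0$ (depending only on $k$) such that if $u,v\in\mathcal{H}^k$ then $uv \in\mathcal{H}^k$ and $\|uv\|_{\mathcal{H}^k}\le C\|u\|_{\mathcal{H}^k}\|v\|_{\mathcal{H}^k}$.
   Context: $D=d/d\zeta$. $AC_{\mathrm{loc}}^{0}((-1,1))$ is the set of functions $(-1,1)\to\mathbb{R}$ that are absolutely continuous on each compact subset of $(-1,1)$, and for $k\ge1$, $AC^k_{\mathrm{loc}}((-1,1)) = \{u \in AC^{k-1}_{\mathrm{loc}}((-1,1)) : D^k u \in AC^0_{\mathrm{loc}}((-1,1))\}$. For $k\ge1$, $$\mathcal{H}^k = \{u \in AC_{\mathrm{loc}}^{k-1}((-1,1)) : \|u\|_{\mathcal{H}^k}<\infty\},\qquad \|u\|_{\mathcal{H}^k}^2 = \sum_{j=0}^k\int_{-1}^1(1-\zeta^2)^j|D^ju(\zeta)|^2\,d\zeta.$$ *)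

theory Defs
  imports "HOL-Analysis.Analysis"
begin

text \<open>
  A function on \<open>(-1, 1)\<close> is represented by a total function on the reals, whose values outside
  that interval are irrelevant: each notion below depends only on the restriction to \<open>(-1, 1)\<close>.
\<close>

text \<open>
  The finite set \<open>P\<close> encodes a family of pairwise disjoint open intervals by their endpoints,
  which have to lie in \<open>S\<close>. For an interval \<open>S\<close> this is the usual notion.
\<close>

definition absolutely_continuous_fun_on :: "real set \<Rightarrow> (real \<Rightarrow> real) \<Rightarrow> bool" where
  "absolutely_continuous_fun_on S f \<longleftrightarrow>
    (\<forall>\<epsilon>>0. \<exists>\<delta>>0. \<forall>P :: (real \<times> real) set.
       finite P \<longrightarrow>
       (\<forall>(a, b)\<in>P. a \<in> S \<and> b \<in> S \<and> a < b) \<longrightarrow>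
       disjoint_family_on (\<lambda>(a, b). {a<..<b}) P \<longrightarrow>
       (\<Sum>(a, b)\<in>P. b - a) < \<delta> \<longrightarrow>
       (\<Sum>(a, b)\<in>P. \<bar>f b - f a\<bar>) < \<epsilon>)"

definition AC_loc0 :: "(real \<Rightarrow> real) set" where
  "AC_loc0 = {u. \<forall>K. compact K \<and> K \<subseteq> {-1<..<1} \<longrightarrow> absolutely_continuous_fun_on K u}"

text \<open>
  Since \<^const>\<open>deriv\<close> is total, the existence of the derivative of order \<open>k + 1\<close> at every
  point of \<open>(-1, 1)\<close> is required explicitly.
\<close>

primrec AC_loc :: "nat \<Rightarrow> (real \<Rightarrow> real) set" where
  "AC_loc 0 = AC_loc0"
| "AC_loc (Suc k) =
    {u \<in> AC_loc k. (\<forall>x\<in>{-1<..<1}. (deriv ^^ k) u differentiable (at x)) \<and>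
                   (deriv ^^ Suc k) u \<in> AC_loc0}"

text \<open>
  The squared norm, possibly infinite. For \<open>u \<in> AC_loc (k - 1)\<close> the derivative of the top order
  \<open>k\<close> exists almost everywhere only; the value of \<^const>\<open>deriv\<close> on the exceptional null set
  does not affect the integral.
\<close>

definition H_sqnorm :: "nat \<Rightarrow> (real \<Rightarrow> real) \<Rightarrow> ennreal" where
  "H_sqnorm k u =
    (\<Sum>j\<le>k. \<integral>\<^sup>+x\<in>{-1<..<1}. ennreal ((1 - x\<^sup>2) ^ j * \<bar>(deriv ^^ j) u x\<bar>\<^sup>2) \<partial>lebesgue)"

text \<open>Meaningful for \<open>k \<ge> 1\<close> only.\<close>

definition H_space :: "nat \<Rightarrow> (real \<Rightarrow> real) set" where
  "H_space k = {u \<in> AC_loc (k - 1). H_sqnorm k u < \<infinity>}"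

text \<open>Agrees with the mathematical norm where the latter is finite, in particular on \<open>H_space k\<close>.\<close>

definition H_norm :: "nat \<Rightarrow> (real \<Rightarrow> real) \<Rightarrow> real" where
  "H_norm k u = sqrt (enn2real (H_sqnorm k u))"

end

theory Submission
  imports Defs
begin

text \<open>
  With \<open>w = 1 - \<zeta>\<^sup>2\<close>, everything rests on the pointwise bound
  \<open>w\<^sup>j |D\<^sup>j u|\<^sup>2 \<le> C \<parallel>u\<parallel>\<^sup>2\<close> for \<open>j < k\<close>. In the Leibniz expansion of
  \<open>w\<^sup>m |D\<^sup>m (u v)|\<^sup>2\<close> with \<open>m \<le> k\<close>, each term then has a factor bounded in this way and a
  factor that is integrable by assumption.

  For \<open>j \<ge> 1\<close> the bound comes from integrating the derivative of \<open>g = w\<^sup>j |D\<^sup>j u|\<^sup>2\<close> away from a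
  point of \<open>[-1/2, 1/2]\<close> where \<open>g\<close> is small: near the end points, the derivative of the weight has
  the sign that absorbs \<open>2 w\<^sup>j D\<^sup>j u D\<^sup>j\<^sup>+\<^sup>1 u\<close> up to \<open>w\<^sup>j\<^sup>+\<^sup>1 |D\<^sup>j\<^sup>+\<^sup>1 u|\<^sup>2\<close>. For
  \<open>j = 0\<close> it follows from the case \<open>j = 1\<close>, since \<open>w\<close> to the power \<open>-1/2\<close> is integrable.

  At the top order this uses that an absolutely continuous function is differentiable almost
  everywhere and is the integral of its derivative. Differentiability is proved by Austin's argument:
  by Vitali's theorem, a set of positive outer measure on which a function has slopes both above and
  below a given value could be used to refine partitions so as to increase the variation by a fixed
  amount.
\<close>

subsection \<open>Inserting opposite moves into a partition\<close>

text \<open>Partitions are sorted lists, so that they are refined by concatenation. Repeated points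
  are allowed, since they add nothing to the variation.\<close>

fun list_variation :: "(real \<Rightarrow> real) \<Rightarrow> real list \<Rightarrow> real" where
  "list_variation f (x # y # zs) = \<bar>f y - f x\<bar> + list_variation f (y # zs)"
| "list_variation f _ = 0"

text \<open>Neighbouring intervals may share an end point. This order form of disjointness makes it
  easy to split a family at one of its members, and it implies the \<open>disjoint_family_on\<close>
  condition of absolute continuity.\<close>

definition nonoverlapping :: "(real \<times> real) set \<Rightarrow> bool" where
  "nonoverlapping P \<longleftrightarrow> (\<forall>c\<in>P. fst c < snd c) \<and>
    (\<forall>c\<in>P. \<forall>d\<in>P. c \<noteq> d \<longrightarrow> snd c \<le> fst d \<or> snd d \<le> fst c)"

lemma nonoverlapping_mono: "nonoverlapping P \<Longrightarrow> Q \<subseteq> P \<Longrightarrow> nonoverlapping Q"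
  unfolding nonoverlapping_def by blast

lemma nonoverlapping_disjoint_family:
  assumes "nonoverlapping P"
  shows "disjoint_family_on (\<lambda>(a, b). {a<..<b}) P"
  using assms unfolding nonoverlapping_def disjoint_family_on_def by fastforce

lemma sorted_le_last: "sorted xs \<Longrightarrow> x \<in> set xs \<Longrightarrow> x \<le> last xs"
  by (induction xs) force+

lemma sorted_subset_hd_last: "sorted xs \<Longrightarrow> set xs \<subseteq> {hd xs..last xs}"
  using sorted_le_last by (cases xs) auto

lemma list_variation_append:
  assumes "xs \<noteq> []" "ys \<noteq> []"
  shows "list_variation f (xs @ ys) =
    list_variation f xs + \<bar>f (hd ys) - f (last xs)\<bar> + list_variation f ys"
  using assms
proof (induction f xs rule: list_variation.induct)
  case ("2_2" f v)
  then show ?case by (cases ys) auto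
qed auto

lemma list_variation_append_ge:
  "list_variation f xs + list_variation f ys \<le> list_variation f (xs @ ys)"
  by (cases "xs = []"; cases "ys = []") (auto simp: list_variation_append)

lemma list_variation_uminus: "list_variation (\<lambda>x. - f x) xs = list_variation f xs"
  by (induction f xs rule: list_variation.induct) auto

lemma list_variation_add:
  "list_variation (\<lambda>x. f x + g x) xs \<le> list_variation f xs + list_variation g xs"
  by (induction f xs rule: list_variation.induct) auto

text \<open>Serves to tilt a function of bounded variation by a linear function while keeping its
  variations bounded.\<close>

lemma list_variation_linear:
  assumes "sorted xs" "set xs \<subseteq> {a..b}" "a \<le> b"
  shows "list_variation (\<lambda>x. c * x) xs \<le> \<bar>c\<bar> * (b - a)"
  using assms
proof (induction "\<lambda>x. c * x" xs arbitrary: a rule: list_variation.induct)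
  case (1 x y zs)
  have "list_variation (\<lambda>x. c * x) (y # zs) \<le> \<bar>c\<bar> * (b - y)"
    using 1 by (intro "1.hyps"(1)) auto
  moreover have "\<bar>c * y - c * x\<bar> = \<bar>c\<bar> * (y - x)"
    using 1 by (simp flip: right_diff_distrib add: abs_mult)
  moreover have "\<bar>c\<bar> * (b - x) \<le> \<bar>c\<bar> * (b - a)"
    using 1 by (intro mult_left_mono) auto
  ultimately show ?case by (simp only: list_variation.simps right_diff_distrib)
qed auto

text \<open>Translates lists into the families of intervals in which bounded variation and absolute
  continuity are expressed. A repeated point yields no interval, because a nonoverlapping family has
  only nondegenerate members.\<close>

lemma list_variation_eq_sum:
  assumes "sorted xs" "xs \<noteq> []"
  shows "\<exists>P. finite P \<and> nonoverlapping P \<and> (\<forall>c\<in>P. hd xs \<le> fst c \<and> snd c \<le> last xs) \<and>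
    list_variation f xs = (\<Sum>(a, b)\<in>P. \<bar>f b - f a\<bar>)"
  using assms
proof (induction f xs rule: list_variation.induct)
  case (1 f x y zs)
  then obtain P where P: "finite P" "nonoverlapping P"
    "\<forall>c\<in>P. y \<le> fst c \<and> snd c \<le> last (y # zs)"
    "list_variation f (y # zs) = (\<Sum>(a, b)\<in>P. \<bar>f b - f a\<bar>)"
    by auto
  have last: "last (y # zs) \<ge> y" using 1 by (cases zs) auto
  show ?case
  proof (cases "x = y")
    case True
    then show ?thesis using P by (intro exI[of _ P]) auto
  next
    case False
    then have "x < y" using 1 by auto
    have "(x, y) \<notin> P" using P(3) \<open>x < y\<close> by force
    then have "(\<Sum>(a, b)\<in>insert (x, y) P. \<bar>f b - f a\<bar>) = list_variation f (x # y # zs)"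
      using P by simp
    moreover have "nonoverlapping (insert (x, y) P)"
      using P(2,3) \<open>x < y\<close> unfolding nonoverlapping_def by auto
    moreover have "\<forall>c\<in>insert (x, y) P. x \<le> fst c \<and> snd c \<le> last (y # zs)"
      using P(3) \<open>x < y\<close> last by auto
    ultimately show ?thesis using P(1)
      by (intro exI[of _ "insert (x, y) P"]) auto
  qed
next
  case ("2_1" f)
  then show ?case by simp
next
  case ("2_2" f v)
  then show ?case by (intro exI[of _ "{}"]) (auto simp: nonoverlapping_def)
qed

text \<open>
  The factor \<open>2\<close>: a fall by \<open>d\<close> inside \<open>[s, t]\<close> contributes \<open>d\<close> itself and forces the rest of the
  interval to rise by an additional \<open>d\<close>.
\<close>

lemma variation_opposing:
  assumes "finite C" "nonoverlapping C" "s \<le> t"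
    and "\<forall>c\<in>C. s \<le> fst c \<and> snd c \<le> t \<and> r * (snd c - fst c) \<le> f (fst c) - f (snd c)"
  shows "\<exists>xs. xs \<noteq> [] \<and> sorted xs \<and> hd xs = s \<and> last xs = t \<and>
    f t - f s + 2 * (r * (\<Sum>c\<in>C. snd c - fst c)) \<le> list_variation f xs"
  using assms
proof (induction "card C" arbitrary: C s t rule: less_induct)
  case less
  show ?case
  proof (cases "C = {}")
    case True
    then show ?thesis using less by (intro exI[of _ "[s, t]"]) auto
  next
    case False
    then obtain c where c: "c \<in> C" by auto
    obtain p q where pq: "c = (p, q)" by (cases c)
    have pqst: "s \<le> p" "q \<le> t" "p < q" "r * (q - p) \<le> f p - f q"
      using less.prems c pq by (auto simp: nonoverlapping_def)
    define L where "L = {d \<in> C. snd d \<le> p}"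
    define R where "R = {d \<in> C. q \<le> fst d}"
    have fin: "finite L" "finite R" using less.prems(1) by (auto simp: L_def R_def)
    \<comment> \<open>Every member other than \<open>c\<close> lies entirely on one side of it, so
      induction applies on \<open>[s, p]\<close> and on \<open>[q, t]\<close>.\<close>
    have C: "C = insert c (L \<union> R)"
      using less.prems(2) c pq unfolding nonoverlapping_def L_def R_def by force
    have notin: "c \<notin> L \<union> R" "L \<inter> R = {}"
      using less.prems(2) pqst(3) pq unfolding nonoverlapping_def L_def R_def by force+
    have card: "card L < card C" "card R < card C"
      using less.prems(1) C notin by (blast intro!: psubset_card_mono)+
    have sub: "nonoverlapping L" "nonoverlapping R"
      using less.prems(2) by (auto intro: nonoverlapping_mono simp: L_def R_def)
    obtain xs where xs: "xs \<noteq> []" "sorted xs" "hd xs = s" "last xs = p"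
      "f p - f s + 2 * (r * (\<Sum>c\<in>L. snd c - fst c)) \<le> list_variation f xs"
      using less.hyps[OF card(1) fin(1) sub(1) pqst(1)] less.prems(4)
      unfolding L_def by auto
    obtain ys where ys: "ys \<noteq> []" "sorted ys" "hd ys = q" "last ys = t"
      "f t - f q + 2 * (r * (\<Sum>c\<in>R. snd c - fst c)) \<le> list_variation f ys"
      using less.hyps[OF card(2) fin(2) sub(2) pqst(2)] less.prems(4)
      unfolding R_def by auto
    have "(\<Sum>c\<in>C. snd c - fst c) = (q - p) + (\<Sum>c\<in>L. snd c - fst c) + (\<Sum>c\<in>R. snd c - fst c)"
      unfolding C using notin fin pq by (subst sum.insert) (auto simp: sum.union_disjoint)
    then have eq: "r * (\<Sum>c\<in>C. snd c - fst c) =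
      r * (q - p) + r * (\<Sum>c\<in>L. snd c - fst c) + r * (\<Sum>c\<in>R. snd c - fst c)"
      by (simp only: distrib_left)
    \<comment> \<open>Passing through \<open>p\<close> and \<open>q\<close> gives
      \<open>(f p - f s) + (f p - f q) + (f t - f q)\<close>, which is
      \<open>(f t - f s) + 2 * (f p - f q)\<close>; the gains from \<open>L\<close> and
      \<open>R\<close> are added to this.\<close>
    have "f t - f s + 2 * (r * (\<Sum>c\<in>C. snd c - fst c)) \<le> list_variation f (xs @ ys)"
      unfolding eq using xs ys pqst(4) by (simp add: list_variation_append)
    moreover have "sorted (xs @ ys)"
    proof -
      have "x \<le> p" if "x \<in> set xs" for x
        using xs that by (metis sorted_le_last)
      moreover have "q \<le> y" if "y \<in> set ys" for y
        using ys that by (cases ys) auto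
      ultimately show ?thesis using xs ys pqst(3) by (force simp: sorted_append)
    qed
    ultimately show ?thesis using xs ys by (intro exI[of _ "xs @ ys"]) auto
  qed
qed

text \<open>These are the moves against the net change over \<open>[s, t]\<close> that increase the
  variation when inserted. A tie \<open>f s = f t\<close> counts as a rise, so that exactly one
  direction is opposing.\<close>

definition opposing :: "(real \<Rightarrow> real) \<Rightarrow> real \<Rightarrow> real \<Rightarrow> real \<Rightarrow> real \<times> real \<Rightarrow> bool" where
  "opposing f r s t c \<longleftrightarrow> s \<le> fst c \<and> snd c \<le> t \<and>
    r * (snd c - fst c) \<le> (if f s \<le> f t then f (fst c) - f (snd c) else f (snd c) - f (fst c))"

lemma variation_opposing_abs:
  assumes "finite C" "nonoverlapping C" "s \<le> t" "\<forall>c\<in>C. opposing f r s t c"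
  shows "\<exists>xs. xs \<noteq> [] \<and> sorted xs \<and> hd xs = s \<and> last xs = t \<and>
    \<bar>f t - f s\<bar> + 2 * (r * (\<Sum>c\<in>C. snd c - fst c)) \<le> list_variation f xs"
proof (cases "f s \<le> f t")
  case True
  then show ?thesis
    using variation_opposing[OF assms(1-3), of r f] assms(4) by (simp add: opposing_def)
next
  case False
  then show ?thesis
    using variation_opposing[OF assms(1-3), of r "\<lambda>x. - f x"] assms(4)
    by (simp add: opposing_def list_variation_uminus)
qed

text \<open>The gains in the separate gaps of the partition add up. The induction treats the
  intervals opposing in the first gap and leaves the others to the tail of the list.\<close>

lemma variation_refine_opposing:
  assumes "finite C" "nonoverlapping C" "sorted xs" "xs \<noteq> []"
    and "\<forall>c\<in>C. \<exists>i. Suc i < length xs \<and> opposing f r (xs ! i) (xs ! Suc i) c"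
  shows "\<exists>ys. ys \<noteq> [] \<and> sorted ys \<and> hd ys = hd xs \<and> last ys = last xs \<and>
    list_variation f xs + 2 * (r * (\<Sum>c\<in>C. snd c - fst c)) \<le> list_variation f ys"
  using assms
proof (induction f xs arbitrary: C rule: list_variation.induct)
  case (1 f x y zs)
  define D where "D = {c \<in> C. opposing f r x y c}"
  have "finite D" "nonoverlapping D" "x \<le> y" "\<forall>c\<in>D. opposing f r x y c"
    using "1.prems"(1-3) by (auto simp: D_def intro: nonoverlapping_mono)
  then obtain us where us: "us \<noteq> []" "sorted us" "hd us = x" "last us = y"
    "\<bar>f y - f x\<bar> + 2 * (r * (\<Sum>c\<in>D. snd c - fst c)) \<le> list_variation f us"
    using variation_opposing_abs by blast
  have "\<exists>i. Suc i < length (y # zs) \<and> opposing f r ((y # zs) ! i) ((y # zs) ! Suc i) c"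
    if c: "c \<in> C - D" for c
  proof -
    obtain i where i: "Suc i < length (x # y # zs)"
      "opposing f r ((x # y # zs) ! i) ((x # y # zs) ! Suc i) c"
      using "1.prems"(5) c by blast
    then show ?thesis using c by (cases i) (auto simp: D_def)
  qed
  then obtain vs where vs: "vs \<noteq> []" "sorted vs" "hd vs = y" "last vs = last (y # zs)"
    "list_variation f (y # zs) + 2 * (r * (\<Sum>c\<in>C - D. snd c - fst c)) \<le> list_variation f vs"
    using "1.IH"[of "C - D", OF _ nonoverlapping_mono[OF "1.prems"(2)]]
      "1.prems"(1,3) by fastforce
  have "(\<Sum>c\<in>C. snd c - fst c) = (\<Sum>c\<in>D. snd c - fst c) + (\<Sum>c\<in>C - D. snd c - fst c)"
    using sum.subset_diff[of D C "\<lambda>c. snd c - fst c"] "1.prems"(1)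
    by (simp add: D_def add.commute)
  then have "r * (\<Sum>c\<in>C. snd c - fst c) =
      r * (\<Sum>c\<in>D. snd c - fst c) + r * (\<Sum>c\<in>C - D. snd c - fst c)"
    by (simp only: distrib_left)
  \<comment> \<open>The refined pieces meet at \<open>y\<close>, which is repeated in the
    concatenation at no cost.\<close>
  then have "list_variation f (x # y # zs) + 2 * (r * (\<Sum>c\<in>C. snd c - fst c)) \<le> list_variation f (us @ vs)"
    using us vs by (simp add: list_variation_append)
  moreover have "sorted (us @ vs)"
  proof -
    have "u \<le> y" if "u \<in> set us" for u
      using us that by (metis sorted_le_last)
    moreover have "y \<le> v" if "v \<in> set vs" for v
      using vs that by (cases vs) auto
    ultimately show ?thesis using us vs by (force simp: sorted_append)
  qed
  ultimately show ?case using us vs by (intro exI[of _ "us @ vs"]) auto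
next
  case ("2_1" f)
  then show ?case by simp
next
  case ("2_2" f v)
  then have "C = {}" by auto
  then show ?case by (intro exI[of _ "[v]"]) auto
qed

text \<open>Stated for families of intervals, the form that absolute continuity delivers;
  \<open>list_variation_le\<close> passes to lists.\<close>

definition bounded_variation_by :: "(real \<Rightarrow> real) \<Rightarrow> real \<Rightarrow> real \<Rightarrow> real \<Rightarrow> bool" where
  "bounded_variation_by f a b B \<longleftrightarrow>
    (\<forall>P. finite P \<and> nonoverlapping P \<and> (\<forall>c\<in>P. a \<le> fst c \<and> snd c \<le> b) \<longrightarrow>
      (\<Sum>(s, t)\<in>P. \<bar>f t - f s\<bar>) \<le> B)"

lemma list_variation_le:
  assumes "bounded_variation_by f a b B" "sorted xs" "set xs \<subseteq> {a..b}"
  shows "list_variation f xs \<le> B"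
proof (cases "xs = []")
  case True
  have "0 \<le> B"
    using assms(1)[unfolded bounded_variation_by_def, rule_format, of "{}"]
    by (simp add: nonoverlapping_def)
  then show ?thesis using True by simp
next
  case False
  then obtain P where P: "finite P" "nonoverlapping P"
    "\<forall>c\<in>P. hd xs \<le> fst c \<and> snd c \<le> last xs"
    "list_variation f xs = (\<Sum>(a, b)\<in>P. \<bar>f b - f a\<bar>)"
    using list_variation_eq_sum assms(2) by blast
  have "a \<le> hd xs" "last xs \<le> b"
    using assms(3) hd_in_set[OF False] last_in_set[OF False] by auto
  then have "\<forall>c\<in>P. a \<le> fst c \<and> snd c \<le> b" using P(3) by force
  then show ?thesis using assms(1) P unfolding bounded_variation_by_def by simp
qed

subsection \<open>Sets of steep or opposite slopes\<close>

text \<open>Vitali's theorem selects countably many disjoint intervals of \<open>K\<close> that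
  cover \<open>S\<close> up to a null set. Their finite subfamilies have total length at most
  \<open>e\<close>, and the bound passes to the countable union. Measure estimates for
  \<open>S\<close> are thus reduced to finite combinatorics.\<close>

lemma Vitali_cover_measure_le:
  assumes K: "\<And>c. c \<in> K \<Longrightarrow> fst c < snd c"
    and cover: "\<And>x d. x \<in> S \<Longrightarrow> 0 < d \<Longrightarrow>
      \<exists>c\<in>K. fst c \<le> x \<and> x \<le> snd c \<and> snd c - fst c < (d :: real)"
    and bound: "\<And>F. finite F \<Longrightarrow> F \<subseteq> K \<Longrightarrow> nonoverlapping F \<Longrightarrow> (\<Sum>c\<in>F. snd c - fst c) \<le> e"
  shows "\<exists>T. S \<subseteq> T \<and> T \<in> lmeasurable \<and> measure lebesgue T \<le> e"
proof -
  let ?m = "\<lambda>c::real \<times> real. (fst c + snd c) / 2" and ?r = "\<lambda>c::real \<times> real. (snd c - fst c) / 2"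
  have ball: "cball (?m c) (?r c) = {fst c..snd c}" for c
    by (simp add: cball_eq_atLeastAtMost field_simps)
  have r: "0 < ?r c" if "c \<in> K" for c using K[OF that] by simp
  have "\<exists>c. c \<in> K \<and> x \<in> cball (?m c) (?r c) \<and> ?r c < d" if xd: "x \<in> S" "0 < d" for x d
  proof -
    obtain c where "c \<in> K" "fst c \<le> x" "x \<le> snd c" "snd c - fst c < d"
      using cover[OF xd] by blast
    moreover from this have "?r c < d" using K[of c] by (simp add: field_simps)
    ultimately show ?thesis unfolding ball by (intro exI[of _ c]) simp
  qed
  from Vitali_covering_theorem_cballs[of K ?r S ?m, OF r this]
  obtain C where C: "countable C" "C \<subseteq> K"
    "pairwise (\<lambda>i j. disjnt (cball (?m i) (?r i)) (cball (?m j) (?r j))) C"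
    "negligible (S - (\<Union>i\<in>C. cball (?m i) (?r i)))" by blast
  let ?U = "\<Union>c\<in>C. {fst c..snd c}"
  have fin: "measure lebesgue (\<Union>c\<in>F. {fst c..snd c}) \<le> e" if F: "F \<subseteq> C" "finite F" for F
  proof -
    have nonoverlapping: "nonoverlapping F"
      unfolding nonoverlapping_def
    proof (intro conjI ballI impI)
      fix c d assume cd: "c \<in> F" "d \<in> F" "c \<noteq> d"
      then have "disjnt {fst c..snd c} {fst d..snd d}"
        using C(3) F(1) unfolding ball pairwise_def by blast
      moreover have "fst c < snd c" "fst d < snd d" using cd F(1) C(2) K by auto
      \<comment> \<open>Two overlapping intervals would both contain the larger of their left end
        points.\<close>
      ultimately show "snd c \<le> fst d \<or> snd d \<le> fst c"
        unfolding disjnt_iff by (auto dest!: spec[of _ "max (fst c) (fst d)"])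
    qed (use F C K in auto)
    have "measure lebesgue (\<Union>c\<in>F. {fst c..snd c}) \<le> (\<Sum>c\<in>F. measure lebesgue {fst c..snd c})"
      using F by (intro measure_UNION_le) auto
    moreover have "(\<Sum>c\<in>F. measure lebesgue {fst c..snd c}) = (\<Sum>c\<in>F. snd c - fst c)"
      using F C(2) K by (intro sum.cong) (auto simp: less_imp_le)
    ultimately show ?thesis using bound[OF F(2) subset_trans[OF F(1) C(2)] nonoverlapping]
      by linarith
  qed
  let ?N = "S - ?U"
  have N: "negligible ?N" using C(4) unfolding ball .
  have U: "?U \<in> lmeasurable"
    by (rule fmeasurable_UN_bound[OF C(1) _ fin]) auto
  have "measure lebesgue ?U \<le> e"
    by (rule measure_UN_bound[OF C(1) _ fin]) auto
  then have "measure lebesgue (?U \<union> ?N) \<le> e"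
    using measure_Un_le[of ?U lebesgue ?N, OF fmeasurableD[OF U] negligible_imp_sets[OF N]]
      negligible_imp_measure0[OF N] by linarith
  moreover have "?U \<union> ?N \<in> lmeasurable"
    using U negligible_imp_measurable[OF N] by (rule fmeasurable.Un)
  ultimately show ?thesis by (intro exI[of _ "?U \<union> ?N"]) auto
qed

lemma sorted_bracket:
  assumes "sorted xs" "xs \<noteq> []" "hd xs < x" "x < last xs" "x \<notin> set xs"
  shows "\<exists>i. Suc i < length xs \<and> xs ! i < x \<and> x < xs ! Suc i"
  using assms
proof (induction xs)
  case (Cons y ys)
  show ?case
  proof (cases "ys = []")
    case True
    then show ?thesis using Cons.prems by simp
  next
    case False
    show ?thesis
    proof (cases "hd ys < x")
      case True
      then obtain i where "Suc i < length ys" "ys ! i < x" "x < ys ! Suc i"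
        using Cons False by auto
      then show ?thesis by (intro exI[of _ "Suc i"]) auto
    next
      case ge: False
      have "x < hd ys" using ge Cons.prems(5) hd_in_set[OF False] by (metis linorder_cases list.set_intros(2))
      then show ?thesis using Cons.prems False by (intro exI[of _ 0]) (auto simp: hd_conv_nth)
    qed
  qed
qed simp

text \<open>Take a partition whose variation is within \<open>2 * (r * e)\<close> of the supremum.
  Opposing intervals inside its gaps form a fine cover of \<open>E\<close> up to the partition
  points. Inserting finitely many of them, of total length \<open>l\<close>, gains
  \<open>2 * (r * l)\<close>, so \<open>l\<close> is at most \<open>e\<close>.\<close>

lemma negligible_opposite_slopes:
  assumes "a < b" "0 < r"
    and BV: "\<And>xs. sorted xs \<Longrightarrow> set xs \<subseteq> {a..b} \<Longrightarrow> list_variation f xs \<le> B"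
    and E: "E \<subseteq> {a<..<b}"
    and down: "\<And>x d. x \<in> E \<Longrightarrow> 0 < d \<Longrightarrow>
      \<exists>p q. p < q \<and> p \<le> x \<and> x \<le> q \<and> q - p < d \<and> r * (q - p) \<le> f p - f q"
    and up: "\<And>x d. x \<in> E \<Longrightarrow> 0 < d \<Longrightarrow>
      \<exists>p q. p < q \<and> p \<le> x \<and> x \<le> q \<and> q - p < d \<and> r * (q - p) \<le> f q - f p"
  shows "negligible E"
  unfolding negligible_outer_le
proof (intro allI impI)
  fix e :: real assume e: "0 < e"
  define A where "A = {list_variation f xs | xs. sorted xs \<and> set xs \<subseteq> {a..b}}"
  have bdd: "bdd_above A" unfolding A_def using BV by (auto intro!: bdd_aboveI[of _ B])
  have "A \<noteq> {}" unfolding A_def by (auto intro!: exI[of _ "[]"])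
  moreover have "Sup A - 2 * (r * e) < Sup A" using e \<open>0 < r\<close> by simp
  ultimately obtain v where "v \<in> A" "Sup A - 2 * (r * e) < v"
    using less_cSupE by meson
  then obtain ys where ys: "sorted ys" "set ys \<subseteq> {a..b}" "Sup A - 2 * (r * e) < list_variation f ys"
    unfolding A_def by auto
  \<comment> \<open>With both end points included, every point of \<open>E\<close> off the partition
    lies strictly inside a gap.\<close>
  define xs where "xs = a # ys @ [b]"
  have xs: "sorted xs" "set xs \<subseteq> {a..b}" "hd xs = a" "last xs = b" "xs \<noteq> []"
    using ys \<open>a < b\<close> by (auto simp: xs_def sorted_append)
  have "list_variation f ys \<le> list_variation f xs"
    using list_variation_append_ge[of f "[a]" "ys @ [b]"] list_variation_append_ge[of f ys "[b]"]
    by (simp add: xs_def)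
  have max: "list_variation f zs \<le> list_variation f xs + 2 * (r * e)"
    if "sorted zs" "set zs \<subseteq> {a..b}" for zs
  proof -
    have "list_variation f zs \<le> Sup A" using that by (intro cSup_upper bdd) (auto simp: A_def)
    then show ?thesis using ys(3) \<open>list_variation f ys \<le> list_variation f xs\<close> by linarith
  qed
  define K where
    "K = {c. fst c < snd c \<and> (\<exists>i. Suc i < length xs \<and> opposing f r (xs ! i) (xs ! Suc i) c)}"
  have "\<exists>T. E - set xs \<subseteq> T \<and> T \<in> lmeasurable \<and> measure lebesgue T \<le> e"
  proof (rule Vitali_cover_measure_le[of K])
    fix x d :: real assume x: "x \<in> E - set xs" and d: "0 < d"
    obtain i where i: "Suc i < length xs" "xs ! i < x" "x < xs ! Suc i"
      using sorted_bracket[OF xs(1,5), of x] xs(3,4) x E by (auto simp: subset_iff)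
    \<comment> \<open>An interval around \<open>x\<close> shorter than \<open>d'\<close> stays
      inside the gap.\<close>
    define d' where "d' = min d (min (x - xs ! i) (xs ! Suc i - x))"
    have "0 < d'" using d i by (simp add: d'_def)
    \<comment> \<open>Whichever way \<open>f\<close> changes over the gap, one of
      \<open>down\<close> and \<open>up\<close> supplies a move against it.\<close>
    have "\<exists>p q. p < q \<and> p \<le> x \<and> x \<le> q \<and> q - p < d' \<and>
        r * (q - p) \<le> (if f (xs ! i) \<le> f (xs ! Suc i) then f p - f q else f q - f p)"
      using down[OF _ \<open>0 < d'\<close>, of x] up[OF _ \<open>0 < d'\<close>, of x] x by auto
    then obtain p q where pq: "p < q" "p \<le> x" "x \<le> q" "q - p < d'"
        "r * (q - p) \<le> (if f (xs ! i) \<le> f (xs ! Suc i) then f p - f q else f q - f p)"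
      by blast
    have "q - p < d" "xs ! i \<le> p" "q \<le> xs ! Suc i"
      using pq(2-4) unfolding d'_def by auto
    then have "(p, q) \<in> K" using pq(1,5) i(1) by (auto simp: K_def opposing_def)
    then show "\<exists>c\<in>K. fst c \<le> x \<and> x \<le> snd c \<and> snd c - fst c < d"
      using pq(2,3) \<open>q - p < d\<close> by (intro bexI[of _ "(p, q)"]) auto
  next
    fix F assume F: "finite F" "F \<subseteq> K" "nonoverlapping F"
    have "\<forall>c\<in>F. \<exists>i. Suc i < length xs \<and> opposing f r (xs ! i) (xs ! Suc i) c"
      using F(2) by (auto simp: K_def)
    then obtain zs where zs: "zs \<noteq> []" "sorted zs" "hd zs = a" "last zs = b"
      "list_variation f xs + 2 * (r * (\<Sum>c\<in>F. snd c - fst c)) \<le> list_variation f zs"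
      using variation_refine_opposing[OF F(1,3) xs(1,5)] xs(3,4)
      by metis
    have "set zs \<subseteq> {a..b}" using sorted_subset_hd_last[OF zs(2)] zs(3,4) by simp
    then have "r * (\<Sum>c\<in>F. snd c - fst c) \<le> r * e" using max[OF zs(2)] zs(5) by linarith
    then show "(\<Sum>c\<in>F. snd c - fst c) \<le> e" using \<open>0 < r\<close> by simp
  qed (auto simp: K_def)
  then obtain T where T: "E - set xs \<subseteq> T" "T \<in> lmeasurable" "measure lebesgue T \<le> e" by blast
  \<comment> \<open>The finitely many partition points were left out of the cover and are now put
    back.\<close>
  have N: "negligible (set xs)" by (simp add: negligible_finite)
  have "measure lebesgue (T \<union> set xs) \<le> e"
    using measure_Un_le[of T lebesgue "set xs", OF fmeasurableD[OF T(2)] negligible_imp_sets[OF N]]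
      negligible_imp_measure0[OF N] T(3) by linarith
  moreover have "T \<union> set xs \<in> lmeasurable"
    using T(2) negligible_imp_measurable[OF N] by (rule fmeasurable.Un)
  ultimately show "\<exists>T. E \<subseteq> T \<and> T \<in> lmeasurable \<and> measure lebesgue T \<le> e"
    using T(1) by (intro exI[of _ "T \<union> set xs"]) auto
qed

text \<open>A nonoverlapping family of intervals with slopes at least \<open>N\<close> in size has
  total length at most \<open>B / N\<close>, and \<open>N\<close> can be taken arbitrarily
  large.\<close>

lemma negligible_unbounded_slopes:
  assumes BV: "bounded_variation_by f a b B"
    and E: "E \<subseteq> {a<..<b}"
    and steep: "\<And>x d N. x \<in> E \<Longrightarrow> 0 < d \<Longrightarrow>
      \<exists>p q. p < q \<and> p \<le> x \<and> x \<le> q \<and> q - p < d \<and> N * (q - p) \<le> \<bar>f q - f p\<bar>"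
  shows "negligible E"
  unfolding negligible_outer_le
proof (intro allI impI)
  fix e :: real assume e: "0 < e"
  \<comment> \<open>Chosen so that \<open>N * e\<close> exceeds \<open>B\<close>; the added 1 keeps
    \<open>N\<close> positive when \<open>B\<close> is zero.\<close>
  define N where "N = (\<bar>B\<bar> + 1) / e"
  have N: "0 < N" using e by (simp add: N_def add_nonneg_pos)
  define K where "K = {c. fst c < snd c \<and> a \<le> fst c \<and> snd c \<le> b \<and>
      N * (snd c - fst c) \<le> \<bar>f (snd c) - f (fst c)\<bar>}"
  show "\<exists>T. E \<subseteq> T \<and> T \<in> lmeasurable \<and> measure lebesgue T \<le> e"
  proof (rule Vitali_cover_measure_le[of K])
    fix x d :: real assume x: "x \<in> E" and d: "0 < d"
    define d' where "d' = min d (min (x - a) (b - x))"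
    have "0 < d'" using d x E by (auto simp: d'_def)
    then obtain p q where pq: "p < q" "p \<le> x" "x \<le> q" "q - p < d'" "N * (q - p) \<le> \<bar>f q - f p\<bar>"
      using steep x by blast
    have "q - p < d" "a \<le> p" "q \<le> b" using pq(2-4) unfolding d'_def by auto
    then show "\<exists>c\<in>K. fst c \<le> x \<and> x \<le> snd c \<and> snd c - fst c < d"
      using pq by (intro bexI[of _ "(p, q)"]) (auto simp: K_def)
  next
    fix F assume F: "finite F" "F \<subseteq> K" "nonoverlapping F"
    have "N * (\<Sum>c\<in>F. snd c - fst c) \<le> (\<Sum>c\<in>F. \<bar>f (snd c) - f (fst c)\<bar>)"
      unfolding sum_distrib_left using F(2) by (intro sum_mono) (auto simp: K_def)
    also have "\<dots> \<le> B"
      using BV[unfolded bounded_variation_by_def, rule_format, of F] F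
      by (auto simp: K_def case_prod_beta)
    also have "B \<le> N * e" using e by (simp add: N_def)
    finally show "(\<Sum>c\<in>F. snd c - fst c) \<le> e" using N by simp
  qed (auto simp: K_def)
qed

subsection \<open>Functions of bounded variation\<close>

text \<open>The limit is the supremum of the numbers that are eventually strict lower bounds. Only
  rational thresholds are tested, which later leaves countably many exceptional sets.\<close>

lemma quotient_converges:
  fixes g :: "real \<Rightarrow> real"
  assumes bdd: "\<forall>\<^sub>F y in at x. \<bar>g y\<bar> < N"
    and dich: "\<And>p q. p \<in> \<rat> \<Longrightarrow> q \<in> \<rat> \<Longrightarrow> p < q \<Longrightarrow>
      (\<forall>\<^sub>F y in at x. p < g y) \<or> (\<forall>\<^sub>F y in at x. g y < q)"
  shows "\<exists>L. (g \<longlongrightarrow> L) (at x)"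
proof -
  define A where "A = {p. \<forall>\<^sub>F y in at x. p < g y}"
  have ne: "-N \<in> A" unfolding A_def using bdd by (auto elim!: eventually_mono)
  have up: "p \<le> N" if "p \<in> A" for p
  proof -
    have "\<forall>\<^sub>F y in at x. p < g y \<and> \<bar>g y\<bar> < N" using that bdd by (auto simp: A_def eventually_conj_iff)
    then obtain y where "p < g y" "\<bar>g y\<bar> < N"
      using eventually_happens by force
    then show ?thesis by linarith
  qed
  have bd: "bdd_above A" using up by (auto intro!: bdd_aboveI)
  have "(g \<longlongrightarrow> Sup A) (at x)"
  proof (rule order_tendstoI)
    fix l assume "l < Sup A"
    then obtain p where "p \<in> A" "l < p" using less_cSupE ne by (metis empty_iff)
    then show "\<forall>\<^sub>F y in at x. l < g y" by (auto simp: A_def elim!: eventually_mono)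
  next
    fix u assume "Sup A < u"
    \<comment> \<open>Two rationals are needed: \<open>p\<close> lies above the supremum and so
      fails the first alternative of \<open>dich\<close>, and the second one then bounds
      \<open>g\<close> by \<open>q\<close>.\<close>
    then obtain p where p: "p \<in> \<rat>" "Sup A < p" "p < u" using Rats_dense_in_real by blast
    then obtain q where q: "q \<in> \<rat>" "p < q" "q < u" using Rats_dense_in_real by blast
    have "p \<notin> A" using cSup_upper[OF _ bd, of p] p(2) by auto
    then have "\<forall>\<^sub>F y in at x. g y < q" using dich[OF p(1) q(1,2)] by (auto simp: A_def)
    then show "\<forall>\<^sub>F y in at x. g y < u" by (rule eventually_mono) (use q in auto)
  qed
  then show ?thesis ..
qed

text \<open>A difference quotient is symmetric in its two points, so a point \<open>y\<close> on
  either side of \<open>x\<close> gives an interval with \<open>x\<close> as an end point. The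
  predicate \<open>R\<close> covers upper, lower and absolute bounds at once.\<close>

lemma frequently_slope:
  fixes f :: "real \<Rightarrow> real"
  assumes fr: "\<exists>\<^sub>F y in at x. R ((f y - f x) / (y - x))" and d: "0 < d"
  shows "\<exists>p q. p < q \<and> p \<le> x \<and> x \<le> q \<and> q - p < d \<and> R ((f q - f p) / (q - p))"
proof -
  have "\<forall>\<^sub>F y in at x. y \<noteq> x \<and> dist y x < d"
    using d unfolding eventually_at by blast
  from frequently_ex[OF frequently_eventually_frequently[OF fr this]]
  obtain y where y: "R ((f y - f x) / (y - x))" "y \<noteq> x" "dist y x < d" by blast
  show ?thesis
  proof (cases "x < y")
    case True
    then show ?thesis using y by (intro exI[of _ x] exI[of _ y]) (auto simp: dist_real_def)
  next
    case False
    have "(f y - f x) / (y - x) = (f x - f y) / (x - y)"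
      using minus_divide_divide[of "f y - f x" "y - x"] by simp
    then have "R ((f x - f y) / (x - y))" using y(1) by metis
    then show ?thesis using y(2,3) False by (intro exI[of _ y] exI[of _ x]) (simp add: dist_real_def)
  qed
qed

text \<open>Where the derivative fails to exist, the difference quotients are either unbounded
  (\<open>U\<close>) or oscillate across a rational gap from \<open>p\<close> to \<open>q\<close>
  (\<open>E p q\<close>). Each of these countably many sets is null.\<close>

lemma negligible_not_differentiable_BV:
  assumes "a < b" and BV: "bounded_variation_by f a b B"
  shows "negligible {x \<in> {a<..<b}. \<not> f differentiable (at x)}"
proof -
  let ?g = "\<lambda>x y. (f y - f x) / (y - x)"
  define U where "U = {x \<in> {a<..<b}. \<forall>N. \<exists>\<^sub>F y in at x. N \<le> \<bar>?g x y\<bar>}"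
  define E where "E p q = {x \<in> {a<..<b}. (\<exists>\<^sub>F y in at x. ?g x y \<le> p) \<and> (\<exists>\<^sub>F y in at x. q \<le> ?g x y)}" for p q
  have "negligible U"
  proof (rule negligible_unbounded_slopes[OF BV])
    fix x d N :: real assume x: "x \<in> U" and d: "0 < d"
    have "\<exists>\<^sub>F y in at x. N \<le> \<bar>?g x y\<bar>" using x by (simp add: U_def)
    from frequently_slope[OF this d] obtain p q where "p < q" "p \<le> x" "x \<le> q" "q - p < d"
      "N \<le> \<bar>(f q - f p) / (q - p)\<bar>" by blast
    then show "\<exists>p q. p < q \<and> p \<le> x \<and> x \<le> q \<and> q - p < d \<and> N * (q - p) \<le> \<bar>f q - f p\<bar>"
      by (intro exI[of _ p] exI[of _ q]) (auto simp: abs_divide pos_le_divide_eq)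
  qed (auto simp: U_def)
  have E: "negligible (E p q)" if "p < q" for p q
  proof -
    \<comment> \<open>Subtracting the midpoint slope \<open>c\<close> turns slopes at most
      \<open>p\<close> and at least \<open>q\<close> into slopes at most \<open>- r\<close> and at
      least \<open>r\<close>.\<close>
    define c where "c = (p + q) / 2"
    define r where "r = (q - p) / 2"
    have "0 < r" using that by (simp add: r_def)
    define h where "h = (\<lambda>x. f x + (- c) * x)"
    show ?thesis
    proof (rule negligible_opposite_slopes[OF \<open>a < b\<close> \<open>0 < r\<close>])
      fix xs assume "sorted xs" "set xs \<subseteq> {a..b}"
      then show "list_variation h xs \<le> B + \<bar>- c\<bar> * (b - a)"
        unfolding h_def using list_variation_add[of f "\<lambda>x. (- c) * x" xs]
          list_variation_le[OF BV, of xs] list_variation_linear[of xs a b "- c"] \<open>a < b\<close>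
        by linarith
    next
      fix x d :: real assume x: "x \<in> E p q" and d: "0 < d"
      have "\<exists>\<^sub>F y in at x. ?g x y \<le> p" using x by (simp add: E_def)
      from frequently_slope[OF this d] obtain s t where st: "s < t" "s \<le> x" "x \<le> t" "t - s < d"
        "(f t - f s) / (t - s) \<le> p" by blast
      then have "f t - f s \<le> p * (t - s)" by (simp add: pos_divide_le_eq)
      then have "r * (t - s) \<le> h s - h t"
        unfolding h_def r_def c_def by (simp add: field_simps)
      then show "\<exists>p q. p < q \<and> p \<le> x \<and> x \<le> q \<and> q - p < d \<and> r * (q - p) \<le> h p - h q"
        using st by blast
    next
      fix x d :: real assume x: "x \<in> E p q" and d: "0 < d"
      have "\<exists>\<^sub>F y in at x. q \<le> ?g x y" using x by (simp add: E_def)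
      from frequently_slope[OF this d] obtain s t where st: "s < t" "s \<le> x" "x \<le> t" "t - s < d"
        "q \<le> (f t - f s) / (t - s)" by blast
      then have "q * (t - s) \<le> f t - f s" by (simp add: pos_le_divide_eq)
      then have "r * (t - s) \<le> h t - h s"
        unfolding h_def r_def c_def by (simp add: field_simps)
      then show "\<exists>p q. p < q \<and> p \<le> x \<and> x \<le> q \<and> q - p < d \<and> r * (q - p) \<le> h q - h p"
        using st by blast
    qed (auto simp: E_def)
  qed
  let ?I = "{(p, q). p \<in> \<rat> \<and> q \<in> \<rat> \<and> p < (q :: real)}"
  have "countable ?I"
    by (rule countable_subset[of _ "\<rat> \<times> \<rat>"]) (auto intro: countable_rat)
  then have "negligible (U \<union> (\<Union>(p, q)\<in>?I. E p q))"
    using \<open>negligible U\<close> E by (intro negligible_Un negligible_countable_Union) auto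
  moreover have "{x \<in> {a<..<b}. \<not> f differentiable (at x)} \<subseteq> U \<union> (\<Union>(p, q)\<in>?I. E p q)"
  proof safe
    fix x assume x: "x \<in> {a<..<b}" "\<not> f differentiable (at x)" "x \<notin> (\<Union>(p, q)\<in>?I. E p q)"
    show "x \<in> U"
    proof (rule ccontr)
      assume "x \<notin> U"
      then obtain N where N: "\<forall>\<^sub>F y in at x. \<bar>?g x y\<bar> < N"
        using x(1) by (auto simp: U_def not_frequently not_le)
      have "\<exists>L. (?g x \<longlongrightarrow> L) (at x)"
      proof (rule quotient_converges[OF N])
        fix p q :: real assume "p \<in> \<rat>" "q \<in> \<rat>" "p < q"
        then have "x \<notin> E p q" using x(3) by auto
        then show "(\<forall>\<^sub>F y in at x. p < ?g x y) \<or> (\<forall>\<^sub>F y in at x. ?g x y < q)"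
          using x(1) by (auto simp: E_def not_frequently not_le)
      qed
      then obtain L where "(?g x \<longlongrightarrow> L) (at x)" ..
      then have "(f has_real_derivative L) (at x)"
        by (simp add: has_field_derivative_iff)
      then show False using x(2) by (metis real_differentiable_def)
    qed
  qed
  ultimately show ?thesis by (rule negligible_subset)
qed

lemma absolutely_continuous_fun_onE:
  assumes "absolutely_continuous_fun_on S f" "0 < \<epsilon>"
  obtains \<delta> where "0 < \<delta>" "\<And>P. finite P \<Longrightarrow> nonoverlapping P \<Longrightarrow>
    (\<And>c. c \<in> P \<Longrightarrow> fst c \<in> S \<and> snd c \<in> S) \<Longrightarrow> (\<Sum>(s, t)\<in>P. t - s) < \<delta> \<Longrightarrow>
    (\<Sum>(s, t)\<in>P. \<bar>f t - f s\<bar>) < \<epsilon>"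
proof -
  obtain \<delta> where \<delta>: "\<delta> > 0" "\<forall>P :: (real \<times> real) set. finite P \<longrightarrow>
       (\<forall>(a, b)\<in>P. a \<in> S \<and> b \<in> S \<and> a < b) \<longrightarrow>
       disjoint_family_on (\<lambda>(a, b). {a<..<b}) P \<longrightarrow>
       (\<Sum>(a, b)\<in>P. b - a) < \<delta> \<longrightarrow> (\<Sum>(a, b)\<in>P. \<bar>f b - f a\<bar>) < \<epsilon>"
    using assms(1)[unfolded absolutely_continuous_fun_on_def, rule_format, OF assms(2)]
    by (elim exE conjE)
  show ?thesis
  proof (rule that[OF \<delta>(1)])
    fix P assume P: "finite P" "nonoverlapping P"
      "\<And>c. c \<in> P \<Longrightarrow> fst c \<in> S \<and> snd c \<in> S" "(\<Sum>(s, t)\<in>P. t - s) < \<delta>"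
    have "\<forall>(a, b)\<in>P. a \<in> S \<and> b \<in> S \<and> a < b"
      using P(2,3) by (fastforce simp: nonoverlapping_def)
    then show "(\<Sum>(s, t)\<in>P. \<bar>f t - f s\<bar>) < \<epsilon>"
      using \<delta>(2) P nonoverlapping_disjoint_family by blast
  qed
qed

subsection \<open>The fundamental theorem of calculus for absolutely continuous functions\<close>

lemma nonoverlapping_sum_le_measure:
  assumes "finite P" "nonoverlapping P" "\<And>c. c \<in> P \<Longrightarrow> {fst c<..<snd c} \<subseteq> U" "U \<in> lmeasurable"
  shows "(\<Sum>(s, t)\<in>P. t - s) \<le> measure lebesgue U"
proof -
  have "pairwise (\<lambda>c d. disjnt {fst c<..<snd c} {fst d<..<snd d}) P"
    using assms(2) unfolding pairwise_def nonoverlapping_def disjnt_iff by fastforce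
  then have "measure lebesgue (\<Union>c\<in>P. {fst c<..<snd c}) = (\<Sum>c\<in>P. measure lebesgue {fst c<..<snd c})"
    using assms(1) by (intro measure_UNION') auto
  also have "\<dots> = (\<Sum>(s, t)\<in>P. t - s)"
    using assms(2) unfolding nonoverlapping_def by (intro sum.cong) (auto simp: case_prod_beta less_imp_le)
  finally show ?thesis
    using measure_mono_fmeasurable[of "\<Union>c\<in>P. {fst c<..<snd c}" U lebesgue] assms(3,4)
    by (simp add: UN_subset_iff borel_open open_UN)
qed

text \<open>On an interval shorter than the \<open>\<delta>\<close> belonging to 1, the variation is
  at most 1. So the result for bounded variation applies near each point, and negligibility is a
  local property.\<close>

lemma negligible_not_differentiable_AC:
  assumes AC: "absolutely_continuous_fun_on {a..b} f"
  shows "negligible {x \<in> {a<..<b}. \<not> f differentiable (at x)}" (is "negligible ?S")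
  unfolding locally_negligible_alt[of ?S]
proof
  fix x assume x: "x \<in> ?S"
  obtain \<delta> where \<delta>: "0 < \<delta>" and small: "\<And>P. finite P \<Longrightarrow> nonoverlapping P \<Longrightarrow>
    (\<And>c. c \<in> P \<Longrightarrow> fst c \<in> {a..b} \<and> snd c \<in> {a..b}) \<Longrightarrow> (\<Sum>(s, t)\<in>P. t - s) < \<delta> \<Longrightarrow>
    (\<Sum>(s, t)\<in>P. \<bar>f t - f s\<bar>) < 1"
    using absolutely_continuous_fun_onE[OF AC, of 1] by auto
  \<comment> \<open>A quarter of \<open>\<delta>\<close> makes the length \<open>2 * \<eta>\<close>
    strictly smaller than \<open>\<delta>\<close>; the other terms keep the interval inside
    \<open>[a, b]\<close>.\<close>
  define \<eta> where "\<eta> = min (\<delta> / 4) (min (x - a) (b - x))"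
  have \<eta>: "0 < \<eta>" "2 * \<eta> < \<delta>" "a \<le> x - \<eta>" "x + \<eta> \<le> b"
    using x \<delta> by (auto simp: \<eta>_def min_def)
  have "bounded_variation_by f (x - \<eta>) (x + \<eta>) 1"
    unfolding bounded_variation_by_def
  proof (intro allI impI, elim conjE)
    fix P assume P: "finite P" "nonoverlapping P" "\<forall>c\<in>P. x - \<eta> \<le> fst c \<and> snd c \<le> x + \<eta>"
    have "(\<Sum>(s, t)\<in>P. t - s) \<le> measure lebesgue {x - \<eta>..x + \<eta>}"
      using P by (intro nonoverlapping_sum_le_measure) force+
    then have "(\<Sum>(s, t)\<in>P. t - s) < \<delta>" using \<eta> by simp
    moreover have "fst c \<in> {a..b} \<and> snd c \<in> {a..b}" if "c \<in> P" for c
    proof -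
      have "x - \<eta> \<le> fst c" "fst c < snd c" "snd c \<le> x + \<eta>"
        using P(2,3) that by (auto simp: nonoverlapping_def)
      then show ?thesis using \<eta> by auto
    qed
    ultimately show "(\<Sum>(s, t)\<in>P. \<bar>f t - f s\<bar>) \<le> 1" using small P(1,2) less_imp_le by blast
  qed
  then have "negligible {y \<in> {x - \<eta><..<x + \<eta>}. \<not> f differentiable (at y)}"
    using \<eta>(1) by (intro negligible_not_differentiable_BV) auto
  then have "negligible (?S \<inter> {x - \<eta><..<x + \<eta>})"
    by (rule negligible_subset) auto
  then show "\<exists>U. openin (top_of_set ?S) U \<and> x \<in> U \<and> negligible U"
    using x \<eta>(1) by (intro exI[of _ "?S \<inter> {x - \<eta><..<x + \<eta>}"]) (auto intro: openin_open_Int)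
qed

text \<open>
  The proof follows that of the fundamental theorem of calculus, except that the gauge confines
  the intervals tagged in the exceptional null set to an open set of small measure, where absolute
  continuity bounds the increments.
\<close>

theorem has_integral_deriv_AC:
  assumes AC: "absolutely_continuous_fun_on {a..b} f" and "a \<le> b"
  shows "(deriv f has_integral (f b - f a)) {a..b}"
proof -
  define N where "N = {x \<in> {a..b}. \<not> f differentiable (at x)}"
  define g where "g = (\<lambda>x. if x \<in> N then 0 else deriv f x)"
  \<comment> \<open>Differentiability is two-sided and may fail at \<open>a\<close> and
    \<open>b\<close>, since nothing is assumed about \<open>f\<close> outside the interval.\<close>
  have "N \<subseteq> {x \<in> {a<..<b}. \<not> f differentiable (at x)} \<union> {a, b}" by (auto simp: N_def)
  then have N: "negligible N"
    using negligible_not_differentiable_AC[OF AC] by (meson negligible_Un negligible_finite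
        negligible_subset finite.emptyI finite_insert)
  have "(g has_integral (f b - f a)) {a..b}"
    unfolding has_integral_real
  proof (intro allI impI)
    fix e :: real assume e: "0 < e"
    \<comment> \<open>The added 1 keeps the divisor positive when \<open>a = b\<close>.\<close>
    define c where "c = b - a + 1"
    define \<epsilon> where "\<epsilon> = e / (2 * c)"
    have c: "0 < c" using \<open>a \<le> b\<close> by (simp add: c_def)
    then have \<epsilon>: "0 < \<epsilon>" using e by (simp add: \<epsilon>_def)
    have "\<epsilon> * (b - a) < \<epsilon> * c" using \<epsilon> by (simp add: c_def)
    also have "\<epsilon> * c = e / 2" using c by (simp add: \<epsilon>_def)
    finally have \<epsilon>_le: "\<epsilon> * (b - a) < e / 2" .
    obtain \<delta> where \<delta>: "0 < \<delta>" and small: "\<And>P. finite P \<Longrightarrow> nonoverlapping P \<Longrightarrow>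
      (\<And>c. c \<in> P \<Longrightarrow> fst c \<in> {a..b} \<and> snd c \<in> {a..b}) \<Longrightarrow> (\<Sum>(s, t)\<in>P. t - s) < \<delta> \<Longrightarrow>
      (\<Sum>(s, t)\<in>P. \<bar>f t - f s\<bar>) < e / 2"
      using absolutely_continuous_fun_onE[OF AC, of "e / 2"] e by auto
    obtain U where U: "open U" "N \<subseteq> U" "U \<in> lmeasurable" "measure lebesgue U < \<delta>"
    proof -
      obtain U where U: "open U" "N \<subseteq> U" "U - N \<in> lmeasurable" "emeasure lebesgue (U - N) < ennreal \<delta>"
        using sets_lebesgue_outer_open[OF negligible_imp_sets[OF N] \<delta>] .
      have Nm: "N \<in> lmeasurable" using N by (rule negligible_imp_measurable)
      have "U = (U - N) \<union> N" using U(2) by auto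
      then have "U \<in> lmeasurable" using fmeasurable.Un[OF U(3) Nm] by simp
      moreover have "measure lebesgue U \<le> measure lebesgue (U - N) + measure lebesgue N"
        using measure_Un_le[OF fmeasurableD[OF U(3)] fmeasurableD[OF Nm]] \<open>U = (U - N) \<union> N\<close> by simp
      moreover have "measure lebesgue (U - N) < \<delta>"
        using U(3,4) by (simp add: emeasure_eq_measure2 ennreal_less_iff)
      ultimately show ?thesis using that U(1,2) negligible_imp_measure0[OF N] by simp
    qed
    have "\<exists>r>0. (x \<in> N \<longrightarrow> ball x r \<subseteq> U) \<and> (x \<in> {a..b} - N \<longrightarrow>
        (\<forall>y. \<bar>y - x\<bar> < r \<longrightarrow> \<bar>f y - f x - g x * (y - x)\<bar> \<le> \<epsilon> * \<bar>y - x\<bar>))" for x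
    proof (cases "x \<in> N")
      case True
      then show ?thesis using U(1,2) open_contains_ball by blast
    next
      case False
      show ?thesis
      proof (cases "x \<in> {a..b}")
        case True
        then have "f differentiable (at x)" using False by (simp add: N_def)
        then have "(f has_real_derivative g x) (at x)"
          using False by (simp add: g_def DERIV_deriv_iff_real_differentiable)
        then have "(f has_derivative (\<lambda>h. g x * h)) (at x)"
          by (simp add: has_field_derivative_def)
        then obtain r where "r > 0" "\<forall>y. norm (y - x) < r \<longrightarrow>
            norm (f y - f x - g x * (y - x)) \<le> \<epsilon> * norm (y - x)"
          using \<epsilon> unfolding has_derivative_at_alt by blast
        then show ?thesis using False by (intro exI[of _ r]) auto
      next
        case False
        then show ?thesis by (intro exI[of _ 1]) (auto simp: N_def)
      qed
    qed
    then obtain r where r: "\<And>x. 0 < r x" "\<And>x. x \<in> N \<Longrightarrow> ball x (r x) \<subseteq> U"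
      "\<And>x y. x \<in> {a..b} - N \<Longrightarrow> \<bar>y - x\<bar> < r x \<Longrightarrow> \<bar>f y - f x - g x * (y - x)\<bar> \<le> \<epsilon> * \<bar>y - x\<bar>"
      by metis
    show "\<exists>\<gamma>. gauge \<gamma> \<and> (\<forall>\<D>. \<D> tagged_division_of {a..b} \<and> \<gamma> fine \<D> \<longrightarrow>
        norm ((\<Sum>(x, K)\<in>\<D>. measure lborel K *\<^sub>R g x) - (f b - f a)) < e)"
    proof (intro exI[of _ "\<lambda>x. ball x (r x)"] conjI allI impI)
      show "gauge (\<lambda>x. ball x (r x))" using r(1) by (rule gauge_ball_dependent[rule_format])
      fix \<D> assume "\<D> tagged_division_of {a..b} \<and> (\<lambda>x. ball x (r x)) fine \<D>"
      then have D: "\<D> tagged_division_of {a..b}" and fine: "(\<lambda>x. ball x (r x)) fine \<D>" by auto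
      have fin: "finite \<D>" using D by blast
      have K: "K = {Inf K..Sup K} \<and> Inf K \<le> x \<and> x \<le> Sup K \<and> a \<le> Inf K \<and> Sup K \<le> b
          \<and> measure lborel K = Sup K - Inf K \<and> K \<subseteq> ball x (r x)" if xK: "(x, K) \<in> \<D>" for x K
      proof -
        have "x \<in> K" "K \<subseteq> {a..b}" using D xK by blast+
        obtain u v where uv: "K = cbox u v" using D xK by blast
        then have "u \<le> v" using \<open>x \<in> K\<close> by auto
        moreover have "K \<subseteq> ball x (r x)" using fine xK by (auto simp: fine_def)
        ultimately show ?thesis using \<open>x \<in> K\<close> \<open>K \<subseteq> {a..b}\<close> uv by (auto simp: cbox_interval)
      qed
      define inc where "inc K = f (Sup K) - f (Inf K)" for K :: "real set"
      define D1 where "D1 = {(x, K) \<in> \<D>. x \<in> N}"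
      define D2 where "D2 = {(x, K) \<in> \<D>. x \<notin> N}"
      have D12: "\<D> = D1 \<union> D2" "D1 \<inter> D2 = {}" "finite D1" "finite D2"
        using fin by (auto simp: D1_def D2_def intro: finite_subset)
      have "(\<Sum>(x, K)\<in>\<D>. measure lborel K *\<^sub>R g x) - (f b - f a)
          = (\<Sum>(x, K)\<in>\<D>. measure lborel K * g x - inc K)"
        using additive_tagged_division_1[OF \<open>a \<le> b\<close> D, of f]
        by (simp add: inc_def sum_subtractf case_prod_beta)
      also have "\<dots> = (\<Sum>(x, K)\<in>D1. measure lborel K * g x - inc K) + (\<Sum>(x, K)\<in>D2. measure lborel K * g x - inc K)"
        unfolding D12(1) using D12 by (intro sum.union_disjoint) auto
      finally have split: "norm ((\<Sum>(x, K)\<in>\<D>. measure lborel K *\<^sub>R g x) - (f b - f a)) \<le>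
          \<bar>\<Sum>(x, K)\<in>D1. measure lborel K * g x - inc K\<bar> + \<bar>\<Sum>(x, K)\<in>D2. measure lborel K * g x - inc K\<bar>"
        by simp
      have "\<bar>\<Sum>(x, K)\<in>D2. measure lborel K * g x - inc K\<bar> \<le> (\<Sum>(x, K)\<in>D2. \<epsilon> * measure lborel K)"
      proof (rule order_trans[OF sum_abs], rule sum_mono, clarify)
        fix x K assume "(x, K) \<in> D2"
        then have xK: "(x, K) \<in> \<D>" "x \<notin> N" by (auto simp: D2_def)
        note k = K[OF xK(1)]
        have len: "measure lborel K = Sup K - Inf K" using k by blast
        have "x \<in> {a..b} - N" using k xK(2) by auto
        moreover have "\<bar>Inf K - x\<bar> < r x" "\<bar>Sup K - x\<bar> < r x"
        proof -
          have "Inf K \<in> K" "Sup K \<in> K" using k by (metis atLeastAtMost_iff order_refl order_trans)+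
          then have "Inf K \<in> ball x (r x)" "Sup K \<in> ball x (r x)" using k by blast+
          then show "\<bar>Inf K - x\<bar> < r x" "\<bar>Sup K - x\<bar> < r x" by (auto simp: dist_real_def)
        qed
        ultimately have "\<bar>f (Inf K) - f x - g x * (Inf K - x)\<bar> \<le> \<epsilon> * \<bar>Inf K - x\<bar>"
          "\<bar>f (Sup K) - f x - g x * (Sup K - x)\<bar> \<le> \<epsilon> * \<bar>Sup K - x\<bar>"
          using r(3) by blast+
        moreover have "measure lborel K * g x - inc K = (f (Inf K) - f x - g x * (Inf K - x))
            - (f (Sup K) - f x - g x * (Sup K - x))"
          unfolding len inc_def by (simp add: algebra_simps)
        \<comment> \<open>The tag lies between the end points, so its distances to them add up to
          the length.\<close>
        moreover have "\<epsilon> * \<bar>Inf K - x\<bar> + \<epsilon> * \<bar>Sup K - x\<bar> = \<epsilon> * measure lborel K"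
          unfolding len using k by (simp flip: distrib_left)
        ultimately show "\<bar>measure lborel K * g x - inc K\<bar> \<le> \<epsilon> * measure lborel K" by linarith
      qed
      also have "\<dots> \<le> (\<Sum>(x, K)\<in>\<D>. \<epsilon> * measure lborel K)"
        using \<epsilon> fin by (intro sum_mono2) (auto simp: D2_def)
      also have "\<dots> = \<epsilon> * (b - a)"
        using additive_content_tagged_division[of \<D> a b] D \<open>a \<le> b\<close>
        by (simp add: case_prod_beta flip: sum_distrib_left)
      finally have two: "\<bar>\<Sum>(x, K)\<in>D2. measure lborel K * g x - inc K\<bar> < e / 2" using \<epsilon>_le by linarith
      \<comment> \<open>Degenerate intervals are dropped: they carry no increment, and
        \<open>nonoverlapping\<close> admits only intervals of positive length.\<close>
      define D3 where "D3 = {(x, K) \<in> D1. Inf K < Sup K}"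
      define J where "J = (\<lambda>(x :: real, K :: real set). (Inf K, Sup K))"
      have D3: "finite D3" "D3 \<subseteq> D1" "D3 \<subseteq> \<D>" using D12 by (auto simp: D3_def intro: finite_subset[of _ D1])
      have apart: "Sup K \<le> Inf L \<or> Sup L \<le> Inf K"
        if "(x, K) \<in> D3" "(y, L) \<in> D3" "(x, K) \<noteq> (y, L)" for x y K L
      proof (rule ccontr)
        assume "\<not> (Sup K \<le> Inf L \<or> Sup L \<le> Inf K)"
        moreover have xy: "(x, K) \<in> \<D>" "(y, L) \<in> \<D>" "Inf K < Sup K" "Inf L < Sup L"
          using that D3 by (auto simp: D3_def)
        ultimately have "max (Inf K) (Inf L) < min (Sup K) (Sup L)" by auto
        then obtain z where "max (Inf K) (Inf L) < z" "z < min (Sup K) (Sup L)" using dense by blast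
        then have "z \<in> {Inf K<..<Sup K}" "z \<in> {Inf L<..<Sup L}" by auto
        then have "z \<in> interior K" "z \<in> interior L"
          using K[OF xy(1)] K[OF xy(2)] interior_atLeastAtMost_real by metis+
        then show False using tagged_division_ofD(5)[OF D xy(1,2) that(3)] by auto
      qed
      \<comment> \<open>\<open>J\<close> forgets the tag. Distinct tagged intervals of positive
        length cannot have the same end points, by \<open>apart\<close>.\<close>
      have inj: "inj_on J D3"
      proof (rule inj_onI, clarify)
        fix x K y L assume xy: "(x, K) \<in> D3" "(y, L) \<in> D3" "J (x, K) = J (y, L)"
        show "x = y \<and> K = L"
        proof (rule ccontr)
          assume "\<not> (x = y \<and> K = L)"
          then show False using apart[OF xy(1,2)] xy by (auto simp: D3_def J_def)
        qed
      qed
      have "nonoverlapping (J ` D3)"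
        unfolding nonoverlapping_def
      proof (intro conjI ballI impI)
        fix c d assume "c \<in> J ` D3" "d \<in> J ` D3" "c \<noteq> d"
        then show "snd c \<le> fst d \<or> snd d \<le> fst c"
          using apart by (fastforce simp: J_def)
      qed (auto simp: D3_def J_def)
      moreover have "{fst c<..<snd c} \<subseteq> U" if "c \<in> J ` D3" for c
      proof -
        obtain x K where xK: "c = J (x, K)" "(x, K) \<in> D3" using \<open>c \<in> J ` D3\<close> by auto
        then have xK': "(x, K) \<in> \<D>" "x \<in> N" by (auto simp: D3_def D1_def)
        have "K \<subseteq> U" using K[OF xK'(1)] r(2)[OF xK'(2)] by blast
        moreover have "{Inf K<..<Sup K} \<subseteq> K" using K[OF xK'(1)]
          by (metis greaterThanLessThan_subseteq_atLeastAtMost_iff order_refl)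
        ultimately show ?thesis by (auto simp: xK(1) J_def)
      qed
      ultimately have "(\<Sum>(s, t)\<in>J ` D3. t - s) \<le> measure lebesgue U"
        using D3 U(3) by (intro nonoverlapping_sum_le_measure) auto
      then have "(\<Sum>(s, t)\<in>J ` D3. t - s) < \<delta>" using U(4) by simp
      moreover have "fst c \<in> {a..b} \<and> snd c \<in> {a..b}" if c: "c \<in> J ` D3" for c
      proof -
        obtain x K where xK: "c = J (x, K)" "(x, K) \<in> D3" using c by auto
        then have "(x, K) \<in> \<D>" using D3 by auto
        from K[OF this] show ?thesis by (auto simp: xK(1) J_def)
      qed
      ultimately have "(\<Sum>(s, t)\<in>J ` D3. \<bar>f t - f s\<bar>) < e / 2"
        using small D3(1) \<open>nonoverlapping (J ` D3)\<close> by blast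
      moreover have "(\<Sum>(s, t)\<in>J ` D3. \<bar>f t - f s\<bar>) = (\<Sum>(x, K)\<in>D3. \<bar>inc K\<bar>)"
        unfolding sum.reindex[OF inj] by (intro sum.cong) (auto simp: J_def inc_def)
      moreover have "(\<Sum>(x, K)\<in>D3. \<bar>inc K\<bar>) = (\<Sum>(x, K)\<in>D1. \<bar>inc K\<bar>)"
      proof (rule sum.mono_neutral_left[OF D12(3) D3(2)], clarify)
        fix x K assume "(x, K) \<in> D1" "(x, K) \<notin> D3"
        moreover from this have "(x, K) \<in> \<D>" by (auto simp: D1_def)
        ultimately have "Inf K = Sup K" using K[of x K] by (force simp: D3_def)
        then show "\<bar>inc K\<bar> = 0" by (simp add: inc_def)
      qed
      moreover have "\<bar>\<Sum>(x, K)\<in>D1. measure lborel K * g x - inc K\<bar> \<le> (\<Sum>(x, K)\<in>D1. \<bar>inc K\<bar>)"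
      proof (rule order_trans[OF sum_abs], rule sum_mono, clarify)
        fix x K assume "(x, K) \<in> D1"
        then have "g x = 0" by (auto simp: D1_def g_def)
        then show "\<bar>measure lborel K * g x - inc K\<bar> \<le> \<bar>inc K\<bar>" by simp
      qed
      ultimately have "\<bar>\<Sum>(x, K)\<in>D1. measure lborel K * g x - inc K\<bar> < e / 2" by linarith
      then show "norm ((\<Sum>(x, K)\<in>\<D>. measure lborel K *\<^sub>R g x) - (f b - f a)) < e"
        using split two by linarith
    qed
  qed
  then show ?thesis
    by (rule has_integral_spike[OF N, rotated]) (simp add: g_def)
qed

subsection \<open>Products and the Leibniz rule\<close>

lemma continuous_on_AC:
  assumes "absolutely_continuous_fun_on S f"
  shows "continuous_on S f"
  unfolding continuous_on_iff
proof (intro ballI allI impI)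
  fix x e :: real assume x: "x \<in> S" and e: "0 < e"
  obtain \<delta> where \<delta>: "0 < \<delta>" "\<And>P. finite P \<Longrightarrow> nonoverlapping P \<Longrightarrow>
    (\<And>c. c \<in> P \<Longrightarrow> fst c \<in> S \<and> snd c \<in> S) \<Longrightarrow> (\<Sum>(s, t)\<in>P. t - s) < \<delta> \<Longrightarrow>
    (\<Sum>(s, t)\<in>P. \<bar>f t - f s\<bar>) < e"
    using absolutely_continuous_fun_onE[OF assms e] by auto
  have "dist (f y) (f x) < e" if y: "y \<in> S" "dist y x < \<delta>" for y
  proof (cases y x rule: linorder_cases)
    case less
    then show ?thesis
      using \<delta>(2)[of "{(y, x)}"] x y by (simp add: nonoverlapping_def dist_real_def abs_minus_commute)
  next
    case greater
    then show ?thesis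
      using \<delta>(2)[of "{(x, y)}"] x y by (simp add: nonoverlapping_def dist_real_def)
  qed (use e in simp)
  then show "\<exists>d>0. \<forall>y\<in>S. dist y x < d \<longrightarrow> dist (f y) (f x) < e" using \<delta>(1) by blast
qed

text \<open>A single criterion that yields constants, sums, products on compact sets, and functions
  that agree on \<open>S\<close>.\<close>

lemma absolutely_continuous_fun_on_bound:
  assumes f: "absolutely_continuous_fun_on S f" and g: "absolutely_continuous_fun_on S g"
    and h: "\<And>x y. x \<in> S \<Longrightarrow> y \<in> S \<Longrightarrow> \<bar>h y - h x\<bar> \<le> B * (\<bar>f y - f x\<bar> + \<bar>g y - g x\<bar>)"
  shows "absolutely_continuous_fun_on S h"
  unfolding absolutely_continuous_fun_on_def
proof (intro allI impI)
  fix \<epsilon> :: real assume \<epsilon>: "0 < \<epsilon>"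
  define C where "C = \<bar>B\<bar> + 1"
  have C: "0 < C" "B \<le> C" by (auto simp: C_def)
  have e: "0 < \<epsilon> / (2 * C)" using \<epsilon> C by simp
  obtain \<delta>f where \<delta>f: "\<delta>f > 0" "\<forall>P :: (real \<times> real) set. finite P \<longrightarrow>
       (\<forall>(a, b)\<in>P. a \<in> S \<and> b \<in> S \<and> a < b) \<longrightarrow> disjoint_family_on (\<lambda>(a, b). {a<..<b}) P \<longrightarrow>
       (\<Sum>(a, b)\<in>P. b - a) < \<delta>f \<longrightarrow> (\<Sum>(a, b)\<in>P. \<bar>f b - f a\<bar>) < \<epsilon> / (2 * C)"
    using f[unfolded absolutely_continuous_fun_on_def, rule_format, OF e] by (elim exE conjE)
  obtain \<delta>g where \<delta>g: "\<delta>g > 0" "\<forall>P :: (real \<times> real) set. finite P \<longrightarrow>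
       (\<forall>(a, b)\<in>P. a \<in> S \<and> b \<in> S \<and> a < b) \<longrightarrow> disjoint_family_on (\<lambda>(a, b). {a<..<b}) P \<longrightarrow>
       (\<Sum>(a, b)\<in>P. b - a) < \<delta>g \<longrightarrow> (\<Sum>(a, b)\<in>P. \<bar>g b - g a\<bar>) < \<epsilon> / (2 * C)"
    using g[unfolded absolutely_continuous_fun_on_def, rule_format, OF e] by (elim exE conjE)
  show "\<exists>\<delta>>0. \<forall>P :: (real \<times> real) set. finite P \<longrightarrow>
       (\<forall>(a, b)\<in>P. a \<in> S \<and> b \<in> S \<and> a < b) \<longrightarrow> disjoint_family_on (\<lambda>(a, b). {a<..<b}) P \<longrightarrow>
       (\<Sum>(a, b)\<in>P. b - a) < \<delta> \<longrightarrow> (\<Sum>(a, b)\<in>P. \<bar>h b - h a\<bar>) < \<epsilon>"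
  proof (intro exI[of _ "min \<delta>f \<delta>g"] conjI allI impI)
    fix P :: "(real \<times> real) set"
    assume P: "finite P" "\<forall>(a, b)\<in>P. a \<in> S \<and> b \<in> S \<and> a < b"
      "disjoint_family_on (\<lambda>(a, b). {a<..<b}) P" "(\<Sum>(a, b)\<in>P. b - a) < min \<delta>f \<delta>g"
    have "(\<Sum>(a, b)\<in>P. \<bar>h b - h a\<bar>) \<le> (\<Sum>(a, b)\<in>P. C * (\<bar>f b - f a\<bar> + \<bar>g b - g a\<bar>))"
    proof (rule sum_mono, clarify)
      fix a b assume "(a, b) \<in> P"
      then have "\<bar>h b - h a\<bar> \<le> B * (\<bar>f b - f a\<bar> + \<bar>g b - g a\<bar>)" using P(2) h by blast
      also have "\<dots> \<le> C * (\<bar>f b - f a\<bar> + \<bar>g b - g a\<bar>)" using C by (intro mult_right_mono) auto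
      finally show "\<bar>h b - h a\<bar> \<le> C * (\<bar>f b - f a\<bar> + \<bar>g b - g a\<bar>)" .
    qed
    also have "\<dots> = C * ((\<Sum>(a, b)\<in>P. \<bar>f b - f a\<bar>) + (\<Sum>(a, b)\<in>P. \<bar>g b - g a\<bar>))"
      unfolding sum.distrib[symmetric] sum_distrib_left by (intro sum.cong) auto
    also have "\<dots> < C * (\<epsilon> / (2 * C) + \<epsilon> / (2 * C))"
    proof (rule mult_strict_left_mono[OF add_strict_mono C(1)])
      show "(\<Sum>(a, b)\<in>P. \<bar>f b - f a\<bar>) < \<epsilon> / (2 * C)" using \<delta>f(2) P by simp
      show "(\<Sum>(a, b)\<in>P. \<bar>g b - g a\<bar>) < \<epsilon> / (2 * C)" using \<delta>g(2) P by simp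
    qed
    also have "\<dots> = \<epsilon>" using C by (simp add: field_simps)
    finally show "(\<Sum>(a, b)\<in>P. \<bar>h b - h a\<bar>) < \<epsilon>" .
  qed (use \<delta>f \<delta>g in auto)
qed

lemma absolutely_continuous_fun_on_ident: "absolutely_continuous_fun_on S (\<lambda>x. x)"
  unfolding absolutely_continuous_fun_on_def
proof (intro allI impI)
  fix \<epsilon> :: real assume "0 < \<epsilon>"
  show "\<exists>\<delta>>0. \<forall>P :: (real \<times> real) set. finite P \<longrightarrow>
       (\<forall>(a, b)\<in>P. a \<in> S \<and> b \<in> S \<and> a < b) \<longrightarrow> disjoint_family_on (\<lambda>(a, b). {a<..<b}) P \<longrightarrow>
       (\<Sum>(a, b)\<in>P. b - a) < \<delta> \<longrightarrow> (\<Sum>(a, b)\<in>P. \<bar>b - a\<bar>) < \<epsilon>"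
  proof (intro exI[of _ \<epsilon>] conjI allI impI)
    fix P :: "(real \<times> real) set"
    assume P: "\<forall>(a, b)\<in>P. a \<in> S \<and> b \<in> S \<and> a < b" "(\<Sum>(a, b)\<in>P. b - a) < \<epsilon>"
    have "(\<Sum>(a, b)\<in>P. \<bar>b - a\<bar>) = (\<Sum>(a, b)\<in>P. b - a)"
      using P(1) by (intro sum.cong) auto
    then show "(\<Sum>(a, b)\<in>P. \<bar>b - a\<bar>) < \<epsilon>" using P(2) by simp
  qed fact
qed

lemma absolutely_continuous_fun_on_mult:
  assumes f: "absolutely_continuous_fun_on S f" and g: "absolutely_continuous_fun_on S g"
    and "compact S"
  shows "absolutely_continuous_fun_on S (\<lambda>x. f x * g x)"
proof -
  have "bounded (f ` S)" "bounded (g ` S)"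
    using assms by (auto intro!: compact_imp_bounded compact_continuous_image continuous_on_AC)
  then obtain Bf Bg where "\<And>x. x \<in> S \<Longrightarrow> \<bar>f x\<bar> \<le> Bf" "\<And>x. x \<in> S \<Longrightarrow> \<bar>g x\<bar> \<le> Bg"
    unfolding bounded_iff by auto
  then have B: "\<bar>f x\<bar> \<le> \<bar>Bf\<bar> + \<bar>Bg\<bar>" "\<bar>g x\<bar> \<le> \<bar>Bf\<bar> + \<bar>Bg\<bar>" if "x \<in> S" for x
    using that by fastforce+
  show ?thesis
  proof (rule absolutely_continuous_fun_on_bound[OF f g])
    fix x y assume xy: "x \<in> S" "y \<in> S"
    have "f y * g y - f x * g x = f y * (g y - g x) + g x * (f y - f x)"
      by (simp add: algebra_simps)
    then have "\<bar>f y * g y - f x * g x\<bar> \<le> \<bar>f y\<bar> * \<bar>g y - g x\<bar> + \<bar>g x\<bar> * \<bar>f y - f x\<bar>"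
      using abs_triangle_ineq[of "f y * (g y - g x)" "g x * (f y - f x)"] by (simp add: abs_mult)
    also have "\<dots> \<le> (\<bar>Bf\<bar> + \<bar>Bg\<bar>) * \<bar>g y - g x\<bar> + (\<bar>Bf\<bar> + \<bar>Bg\<bar>) * \<bar>f y - f x\<bar>"
      using B xy by (intro add_mono mult_right_mono) auto
    finally show "\<bar>f y * g y - f x * g x\<bar> \<le> (\<bar>Bf\<bar> + \<bar>Bg\<bar>) * (\<bar>f y - f x\<bar> + \<bar>g y - g x\<bar>)"
      by (simp add: algebra_simps)
  qed
qed

section \<open>Local absolute continuity on the open interval\<close>

lemma AC_loc0_cong:
  assumes "u \<in> AC_loc0" "\<And>x. x \<in> {-1<..<1} \<Longrightarrow> v x = u x"
  shows "v \<in> AC_loc0"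
  unfolding AC_loc0_def
proof (intro CollectI allI impI)
  fix K assume K: "compact K \<and> K \<subseteq> {-1<..<1::real}"
  then have u: "absolutely_continuous_fun_on K u" using assms(1) by (simp add: AC_loc0_def)
  have "v x = u x" if "x \<in> K" for x using K assms(2) that by blast
  then show "absolutely_continuous_fun_on K v"
    by (intro absolutely_continuous_fun_on_bound[OF u u, of _ 1]) auto
qed

lemma AC_loc0_const: "(\<lambda>x. c) \<in> AC_loc0"
  unfolding AC_loc0_def
  by (auto intro!: absolutely_continuous_fun_on_bound[OF absolutely_continuous_fun_on_ident
        absolutely_continuous_fun_on_ident, where B = 1])

lemma AC_loc0_ident: "(\<lambda>x. x) \<in> AC_loc0"
  by (simp add: AC_loc0_def absolutely_continuous_fun_on_ident)

lemma AC_loc0_add: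
  assumes "u \<in> AC_loc0" "v \<in> AC_loc0" shows "(\<lambda>x. u x + v x) \<in> AC_loc0"
  unfolding AC_loc0_def
proof (intro CollectI allI impI)
  fix K assume "compact K \<and> K \<subseteq> {-1<..<1::real}"
  then have "absolutely_continuous_fun_on K u" "absolutely_continuous_fun_on K v"
    using assms by (auto simp: AC_loc0_def)
  then show "absolutely_continuous_fun_on K (\<lambda>x. u x + v x)"
    by (rule absolutely_continuous_fun_on_bound[where B = 1]) auto
qed

lemma AC_loc0_mult: "u \<in> AC_loc0 \<Longrightarrow> v \<in> AC_loc0 \<Longrightarrow> (\<lambda>x. u x * v x) \<in> AC_loc0"
  by (simp add: AC_loc0_def absolutely_continuous_fun_on_mult)

lemma AC_loc0_power: "u \<in> AC_loc0 \<Longrightarrow> (\<lambda>x. u x ^ n) \<in> AC_loc0"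
  by (induction n) (auto intro: AC_loc0_const AC_loc0_mult)

lemma AC_loc0_sum: "(\<And>i. i \<in> A \<Longrightarrow> u i \<in> AC_loc0) \<Longrightarrow> (\<lambda>x. \<Sum>i\<in>A. u i x) \<in> AC_loc0"
  by (induction A rule: infinite_finite_induct) (auto intro: AC_loc0_const AC_loc0_add)

lemma AC_loc0_imp_AC: "u \<in> AC_loc0 \<Longrightarrow> -1 < a \<Longrightarrow> b < 1 \<Longrightarrow> absolutely_continuous_fun_on {a..b} u"
  unfolding AC_loc0_def by (drule CollectD, drule spec[of _ "{a..b}"]) auto

lemma AC_loc0_continuous_on:
  assumes "u \<in> AC_loc0"
  shows "continuous_on {-1<..<1} u"
proof (intro continuous_at_imp_continuous_on ballI)
  fix x :: real assume x: "x \<in> {-1<..<1}"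
  \<comment> \<open>The midpoint between \<open>\<bar>x\<bar>\<close> and 1, so that
    \<open>x\<close> is interior to a compact interval inside \<open>(-1, 1)\<close>.\<close>
  define c where "c = (1 + \<bar>x\<bar>) / 2"
  have "c < 1" "\<bar>x\<bar> < c" using x by (auto simp: c_def)
  then have "x \<in> interior {-c..c}" "-1 < - c" by (auto simp: interior_atLeastAtMost_real)
  then show "isCont u x"
    using continuous_on_interior[OF continuous_on_AC[OF AC_loc0_imp_AC[OF assms]]] \<open>c < 1\<close> by metis
qed

lemma AC_loc0_has_integral:
  "u \<in> AC_loc0 \<Longrightarrow> -1 < a \<Longrightarrow> a \<le> b \<Longrightarrow> b < 1 \<Longrightarrow> (deriv u has_integral (u b - u a)) {a..b}"
  by (intro has_integral_deriv_AC AC_loc0_imp_AC)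

text \<open>Radii for exhausting \<open>(-1, 1)\<close> by smaller intervals. The offset makes the
  radius 1/2, hence positive, already for \<open>n = 0\<close>.\<close>

definition inner_radius :: "nat \<Rightarrow> real" where
  "inner_radius n = 1 - inverse (real (Suc (Suc n)))"

lemma inner_radius_bounds: "0 < inner_radius n" "inner_radius n < 1"
  by (auto simp: inner_radius_def inverse_eq_divide field_simps)

lemma inner_radius_UN: "{-1<..<1} = (\<Union>n. {- inner_radius n<..<inner_radius n})"
proof (intro equalityI subsetI)
  fix x :: real assume "x \<in> {-1<..<1}"
  then have "0 < 1 - \<bar>x\<bar>" by auto
  from reals_Archimedean[OF this] obtain n where n: "inverse (real (Suc n)) < 1 - \<bar>x\<bar>" ..
  have "inverse (real (Suc (Suc n))) \<le> inverse (real (Suc n))" by (intro le_imp_inverse_le) auto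
  then have "\<bar>x\<bar> < inner_radius n" using n unfolding inner_radius_def by linarith
  then have "x \<in> {- inner_radius n<..<inner_radius n}" by auto
  then show "x \<in> (\<Union>n. {- inner_radius n<..<inner_radius n})" by blast
next
  fix x assume "x \<in> (\<Union>n. {- inner_radius n<..<inner_radius n})"
  then obtain n where "- inner_radius n < x" "x < inner_radius n" by auto
  then show "x \<in> {-1<..<1}" using inner_radius_bounds(2)[of n] by auto
qed

lemma AC_loc0_negligible_not_differentiable:
  assumes "u \<in> AC_loc0"
  shows "negligible {x \<in> {-1<..<1}. \<not> u differentiable (at x)}"
proof -
  have "negligible {x \<in> {- inner_radius n<..<inner_radius n}. \<not> u differentiable (at x)}" for n
    using inner_radius_bounds[of n] assms
    by (intro negligible_not_differentiable_AC AC_loc0_imp_AC) auto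
  then have "negligible (\<Union>n. {x \<in> {- inner_radius n<..<inner_radius n}. \<not> u differentiable (at x)})"
    by (intro negligible_Union_nat)
  moreover have "{x \<in> {-1<..<1}. \<not> u differentiable (at x)} =
      (\<Union>n. {x \<in> {- inner_radius n<..<inner_radius n}. \<not> u differentiable (at x)})"
    unfolding inner_radius_UN by auto
  ultimately show ?thesis by simp
qed

lemma AC_loc0_measurable:
  assumes "u \<in> AC_loc0"
  shows "u \<in> borel_measurable (lebesgue_on {-1<..<1})"
  by (rule continuous_imp_measurable_on_sets_lebesgue[OF AC_loc0_continuous_on[OF assms]]) simp

text \<open>On each inner interval the derivative is integrable by the fundamental theorem, hence
  measurable, whatever values \<open>deriv\<close> takes on the exceptional null set. The pieces are
  then glued together.\<close>

lemma AC_loc0_deriv_measurable: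
  assumes "u \<in> AC_loc0"
  shows "deriv u \<in> borel_measurable (lebesgue_on {-1<..<1})"
proof (rule measurable_piecewise_restrict2[of "\<lambda>n. {- inner_radius n<..<inner_radius n}"])
  show "{- inner_radius n<..<inner_radius n} \<in> sets (lebesgue_on {-1<..<1})" for n
    using inner_radius_UN by (auto simp: sets_restrict_space_iff)
  show "space (lebesgue_on {-1<..<1}) = (\<Union>n. {- inner_radius n<..<inner_radius n})"
    using inner_radius_UN by simp
  fix n
  define h where "h = (\<lambda>x. if x \<in> {- inner_radius n..inner_radius n} then deriv u x else 0)"
  have "deriv u integrable_on {- inner_radius n..inner_radius n}"
    using AC_loc0_has_integral[OF assms, of "- inner_radius n" "inner_radius n"] inner_radius_bounds[of n]
    by (auto simp: integrable_on_def)
  then have "deriv u \<in> borel_measurable (lebesgue_on {- inner_radius n..inner_radius n})"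
    by (rule integrable_imp_measurable)
  then have "h \<in> borel_measurable lebesgue"
    unfolding h_def by (intro borel_measurable_if_I) auto
  then have "h \<in> borel_measurable (lebesgue_on {-1<..<1})"
    by (rule measurable_restrict_space1)
  moreover have "\<forall>x\<in>{- inner_radius n<..<inner_radius n}. deriv u x = h x" by (auto simp: h_def)
  ultimately show "\<exists>h\<in>borel_measurable (lebesgue_on {-1<..<1}).
      \<forall>x\<in>{- inner_radius n<..<inner_radius n}. deriv u x = h x" by blast
qed

section \<open>Iterated derivatives of a product\<close>

lemma AC_loc_iff:
  "u \<in> AC_loc m \<longleftrightarrow> (\<forall>j\<le>m. (deriv ^^ j) u \<in> AC_loc0) \<and>
    (\<forall>j<m. \<forall>x\<in>{-1<..<1}. (deriv ^^ j) u differentiable (at x))"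
proof (induction m)
  case (Suc m)
  show ?case unfolding AC_loc.simps mem_Collect_eq Suc by (auto simp: le_Suc_eq less_Suc_eq)
qed simp

text \<open>Pascal's rule; \<open>A i l\<close> stands for the product of the derivatives of orders
  \<open>i\<close> and \<open>l\<close>.\<close>

lemma Leibniz_sum_Suc:
  fixes A :: "nat \<Rightarrow> nat \<Rightarrow> real"
  shows "(\<Sum>i\<le>n. of_nat (n choose i) * (A (Suc i) (n - i) + A i (Suc (n - i)))) =
    (\<Sum>i\<le>Suc n. of_nat (Suc n choose i) * A i (Suc n - i))"
proof -
  \<comment> \<open>The sum may be extended to \<open>Suc n\<close> because
    \<open>n choose Suc n\<close> is zero.\<close>
  have "(\<Sum>i\<le>n. of_nat (n choose i) * A i (Suc (n - i))) =
      (\<Sum>i\<le>Suc n. of_nat (n choose i) * A i (Suc n - i))"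
    by (simp add: Suc_diff_le)
  also have "\<dots> = A 0 (Suc n) + (\<Sum>i\<le>n. of_nat (n choose Suc i) * A (Suc i) (n - i))"
    by (subst sum.atMost_Suc_shift) simp
  finally have "(\<Sum>i\<le>n. of_nat (n choose i) * A i (Suc (n - i))) =
      A 0 (Suc n) + (\<Sum>i\<le>n. of_nat (n choose Suc i) * A (Suc i) (n - i))" .
  moreover have "(\<Sum>i\<le>Suc n. of_nat (Suc n choose i) * A i (Suc n - i)) =
      A 0 (Suc n) + (\<Sum>i\<le>n. of_nat (Suc n choose Suc i) * A (Suc i) (n - i))"
    by (subst sum.atMost_Suc_shift) simp
  ultimately show ?thesis by (simp add: sum.distrib distrib_left distrib_right)
qed

text \<open>The formula of order \<open>j\<close> is assumed on the whole interval but
  differentiability only at \<open>x\<close>. The step therefore works at every point for lower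
  orders and almost everywhere at the top order.\<close>

lemma Leibniz_step:
  fixes u v :: "real \<Rightarrow> real"
  assumes eq: "\<And>y. y \<in> {-1<..<1} \<Longrightarrow> (deriv ^^ j) (\<lambda>x. u x * v x) y =
      (\<Sum>i\<le>j. of_nat (j choose i) * ((deriv ^^ i) u y * (deriv ^^ (j - i)) v y))"
    and x: "x \<in> {-1<..<1}"
    and diff: "\<And>i. i \<le> j \<Longrightarrow> (deriv ^^ i) u differentiable (at x)"
      "\<And>i. i \<le> j \<Longrightarrow> (deriv ^^ i) v differentiable (at x)"
  shows "(deriv ^^ j) (\<lambda>x. u x * v x) differentiable (at x)"
    and "(deriv ^^ Suc j) (\<lambda>x. u x * v x) x =
      (\<Sum>i\<le>Suc j. of_nat (Suc j choose i) * ((deriv ^^ i) u x * (deriv ^^ (Suc j - i)) v x))"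
proof -
  let ?A = "\<lambda>i l. (deriv ^^ i) u x * (deriv ^^ l) v x"
  have u: "((deriv ^^ i) u has_real_derivative (deriv ^^ Suc i) u x) (at x)" if "i \<le> j" for i
    using diff(1)[OF that] by (simp add: DERIV_deriv_iff_real_differentiable)
  have v: "((deriv ^^ i) v has_real_derivative (deriv ^^ Suc i) v x) (at x)" if "i \<le> j" for i
    using diff(2)[OF that] by (simp add: DERIV_deriv_iff_real_differentiable)
  have "((\<lambda>y. \<Sum>i\<le>j. of_nat (j choose i) * ((deriv ^^ i) u y * (deriv ^^ (j - i)) v y))
      has_real_derivative (\<Sum>i\<le>j. of_nat (j choose i) * (?A (Suc i) (j - i) + ?A i (Suc (j - i))))) (at x)"
    by (intro DERIV_sum DERIV_cmult, rule DERIV_cong[OF DERIV_mult[OF u v]]) auto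
  then have D: "((deriv ^^ j) (\<lambda>x. u x * v x) has_real_derivative
      (\<Sum>i\<le>Suc j. of_nat (Suc j choose i) * ?A i (Suc j - i))) (at x)"
    unfolding Leibniz_sum_Suc[of j ?A]
    by (rule has_field_derivative_transform_within_open[OF _ open_greaterThanLessThan x])
      (simp only: eq)
  then show "(deriv ^^ j) (\<lambda>x. u x * v x) differentiable (at x)"
    by (auto simp: real_differentiable_def)
  show "(deriv ^^ Suc j) (\<lambda>x. u x * v x) x =
      (\<Sum>i\<le>Suc j. of_nat (Suc j choose i) * ((deriv ^^ i) u x * (deriv ^^ (Suc j - i)) v x))"
    using DERIV_imp_deriv[OF D] by simp
qed

lemma Leibniz_AC_loc:
  assumes u: "u \<in> AC_loc m" and v: "v \<in> AC_loc m" and "j \<le> m" "y \<in> {-1<..<1}"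
  shows "(deriv ^^ j) (\<lambda>x. u x * v x) y =
      (\<Sum>i\<le>j. of_nat (j choose i) * ((deriv ^^ i) u y * (deriv ^^ (j - i)) v y))"
  using assms(3,4)
proof (induction j arbitrary: y)
  case (Suc j)
  show ?case
    using Suc u v by (intro Leibniz_step) (auto simp: AC_loc_iff)
qed simp

lemma AC_loc_mult:
  assumes u: "u \<in> AC_loc m" and v: "v \<in> AC_loc m"
  shows "(\<lambda>x. u x * v x) \<in> AC_loc m"
  unfolding AC_loc_iff
proof (intro conjI allI impI ballI)
  fix j assume j: "j \<le> m"
  have "(\<lambda>y. \<Sum>i\<le>j. of_nat (j choose i) * ((deriv ^^ i) u y * (deriv ^^ (j - i)) v y)) \<in> AC_loc0"
    using j u v unfolding AC_loc_iff
    by (intro AC_loc0_sum AC_loc0_mult[OF AC_loc0_const] AC_loc0_mult) auto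
  then show "(deriv ^^ j) (\<lambda>x. u x * v x) \<in> AC_loc0"
    by (rule AC_loc0_cong) (rule Leibniz_AC_loc[OF u v j])
next
  fix j x assume j: "j < m" and x: "x \<in> {-1<..<1::real}"
  show "(deriv ^^ j) (\<lambda>x. u x * v x) differentiable (at x)"
    using u v j x by (intro Leibniz_step(1)[of j u v] Leibniz_AC_loc[OF u v]) (auto simp: AC_loc_iff)
qed

subsection \<open>Weighted pointwise bounds\<close>

definition weighted_sqnorm :: "nat \<Rightarrow> (real \<Rightarrow> real) \<Rightarrow> ennreal" where
  "weighted_sqnorm j f = (\<integral>\<^sup>+x\<in>{-1<..<1}. ennreal ((1 - x\<^sup>2) ^ j * \<bar>f x\<bar>\<^sup>2) \<partial>lebesgue)"

lemma H_sqnorm_eq_weighted_sqnorm: "H_sqnorm k u = (\<Sum>j\<le>k. weighted_sqnorm j ((deriv ^^ j) u))"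
  by (simp add: H_sqnorm_def weighted_sqnorm_def)

lemma weight_pos: "x \<in> {-1<..<1} \<Longrightarrow> 0 < 1 - (x::real)\<^sup>2"
  by (auto simp: abs_square_less_1 abs_less_iff)

text \<open>With \<open>a\<close> and \<open>b\<close> the values of a function and its derivative
  at \<open>r\<close>, the left side is the derivative of \<open>w ^ c * a\<^sup>2\<close> divided
  by \<open>w ^ (c - 1)\<close>. For \<open>r\<close> up to 1/2 the weight is at least 3/4 and
  powers of it are comparable. Beyond 1/2, the term with \<open>- 2 * c * r\<close> absorbs the
  \<open>a\<^sup>2\<close> produced by the product \<open>2 * w * a * b\<close>.\<close>

lemma weight_increment_bound_aux:
  fixes r a b c :: real
  assumes r: "-1/2 \<le> r" "r < 1" and c: "1 \<le> c"
  shows "2 * (1 - r\<^sup>2) * a * b - 2 * c * r * a\<^sup>2 \<le> 2 * (c + 1) * ((1 - r\<^sup>2) * a\<^sup>2 + (1 - r\<^sup>2)\<^sup>2 * b\<^sup>2)"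
proof -
  define w where "w = 1 - r\<^sup>2"
  have w: "0 < w" using r weight_pos[of r] by (simp add: w_def)
  have nn: "0 \<le> w * a\<^sup>2" "0 \<le> w\<^sup>2 * b\<^sup>2" "0 \<le> a\<^sup>2" using w by auto
  have "2 * w * a * b - 2 * c * r * a\<^sup>2 \<le> 2 * (c + 1) * (w * a\<^sup>2 + w\<^sup>2 * b\<^sup>2)"
  proof (cases "r \<le> 1/2")
    case True
    have "\<bar>r\<bar> \<le> 1/2" using r True by auto
    then have "r\<^sup>2 \<le> (1/2)\<^sup>2" using abs_le_square_iff[of r "1/2"] by simp
    then have w34: "3/4 \<le> w" by (simp add: w_def power2_eq_square)
    have "0 \<le> w * (a - b)\<^sup>2" using w by simp
    then have 1: "2 * w * a * b \<le> w * a\<^sup>2 + w * b\<^sup>2" by (simp add: power2_eq_square algebra_simps)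
    have "3 * (w * b\<^sup>2) \<le> 4 * w * (w * b\<^sup>2)" using w34 w by (intro mult_right_mono) auto
    then have 2: "3 * (w * b\<^sup>2) \<le> 4 * (w\<^sup>2 * b\<^sup>2)" by (simp add: power2_eq_square algebra_simps)
    have c0: "0 \<le> c * a\<^sup>2" using c nn(3) by simp
    have "- 2 * r * (c * a\<^sup>2) \<le> 1 * (c * a\<^sup>2)"
      by (rule mult_right_mono[OF _ c0]) (use r in simp)
    moreover have "3 * (c * a\<^sup>2) \<le> (4 * w) * (c * a\<^sup>2)"
      by (rule mult_right_mono[OF _ c0]) (use w34 in simp)
    moreover have "(4 * w) * (c * a\<^sup>2) = 4 * (c * (w * a\<^sup>2))" "- 2 * r * (c * a\<^sup>2) = - (2 * c * r * a\<^sup>2)"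
      by simp_all
    moreover have "0 \<le> c * (w * a\<^sup>2)" using c nn(1) by simp
    ultimately have 3: "- (2 * c * r * a\<^sup>2) \<le> 2 * (c * (w * a\<^sup>2))" by linarith
    have "0 \<le> c * (w\<^sup>2 * b\<^sup>2)" using c nn(2) by simp
    then have "2 * w * a * b - 2 * c * r * a\<^sup>2
        \<le> 2 * (c * (w * a\<^sup>2)) + 2 * (w * a\<^sup>2) + 2 * (c * (w\<^sup>2 * b\<^sup>2)) + 2 * (w\<^sup>2 * b\<^sup>2)"
      using 1 2 3 nn by linarith
    then show ?thesis by (simp add: algebra_simps)
  next
    case False
    have "0 \<le> (a - w * b)\<^sup>2" by simp
    then have 1: "2 * w * a * b \<le> a\<^sup>2 + w\<^sup>2 * b\<^sup>2" by (simp add: power2_eq_square algebra_simps)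
    have "1 * 1 \<le> c * (2 * r)" using c False by (intro mult_mono) auto
    then have "1 * a\<^sup>2 \<le> c * (2 * r) * a\<^sup>2" using nn(3) by (intro mult_right_mono) auto
    then have 2: "a\<^sup>2 \<le> 2 * c * r * a\<^sup>2" by (simp add: algebra_simps)
    have "0 \<le> c * (w\<^sup>2 * b\<^sup>2)" "0 \<le> c * (w * a\<^sup>2)" using c nn(1,2) by simp_all
    then have "2 * w * a * b - 2 * c * r * a\<^sup>2
        \<le> 2 * (c * (w * a\<^sup>2)) + 2 * (w * a\<^sup>2) + 2 * (c * (w\<^sup>2 * b\<^sup>2)) + 2 * (w\<^sup>2 * b\<^sup>2)"
      using 1 2 nn by linarith
    then show ?thesis by (simp add: algebra_simps)
  qed
  then show ?thesis by (simp add: w_def)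
qed

text \<open>The sign \<open>s\<close> reflects the interval, so that both end points are covered:
  substitute \<open>s * t\<close> and \<open>s * b\<close> and use that \<open>s\<close> squares to
  1.\<close>

lemma weight_increment_bound:
  fixes t a b c s :: real
  assumes t: "\<bar>t\<bar> < 1" and s: "s = 1 \<or> s = -1" and st: "-1/2 \<le> s * t" and c: "1 \<le> c"
  shows "s * (2 * (1 - t\<^sup>2) * a * b - 2 * c * t * a\<^sup>2)
    \<le> 2 * (c + 1) * ((1 - t\<^sup>2) * a\<^sup>2 + (1 - t\<^sup>2)\<^sup>2 * b\<^sup>2)"
  using weight_increment_bound_aux[of "s * t" c a "s * b"] assms
  by (auto simp: algebra_simps)

text \<open>Passes from the extended nonnegative integral of the norms to the gauge integral of the
  fundamental theorem.\<close>

lemma integral_le_nn_integral: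
  fixes \<phi> :: "real \<Rightarrow> real"
  assumes meas: "\<phi> \<in> borel_measurable (lebesgue_on S)" and "S \<in> sets lebesgue"
    and nonneg: "\<And>x. x \<in> S \<Longrightarrow> 0 \<le> \<phi> x"
    and le: "(\<integral>\<^sup>+x\<in>S. ennreal (\<phi> x) \<partial>lebesgue) \<le> ennreal M" and "0 \<le> M"
    and sub: "{a..b} \<subseteq> S"
  shows "\<exists>I. (\<phi> has_integral I) {a..b} \<and> I \<le> M"
proof -
  define \<psi> where "\<psi> = (\<lambda>x. indicator {a..b} x *\<^sub>R \<phi> x)"
  have "\<phi> \<in> borel_measurable (lebesgue_on {a..b})"
    using meas sub measurable_restrict_mono by blast
  then have m: "\<psi> \<in> borel_measurable lebesgue"
    unfolding \<psi>_def by (subst (asm) borel_measurable_restrict_space_iff) auto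
  have nn: "0 \<le> \<psi> x" for x using nonneg sub by (auto simp: \<psi>_def indicator_def)
  have "(\<integral>\<^sup>+x. ennreal (\<psi> x) \<partial>lebesgue) \<le> (\<integral>\<^sup>+x\<in>S. ennreal (\<phi> x) \<partial>lebesgue)"
    using sub by (intro nn_integral_mono) (auto simp: \<psi>_def indicator_def)
  then have bound: "(\<integral>\<^sup>+x. ennreal (\<psi> x) \<partial>lebesgue) \<le> ennreal M" using le by (rule order_trans)
  then have int: "integrable lebesgue \<psi>"
    using m nn by (intro integrableI_nonneg) (auto simp: ennreal_less_top le_less_trans)
  have "(\<phi> has_integral (LINT x:{a..b}|lebesgue. \<phi> x)) {a..b}"
    using int by (intro has_integral_set_lebesgue) (simp add: set_integrable_def \<psi>_def)
  moreover have "(LINT x:{a..b}|lebesgue. \<phi> x) \<le> M"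
    using bound nn_integral_eq_integral[OF int] nn \<open>0 \<le> M\<close>
    by (simp add: set_lebesgue_integral_def \<psi>_def)
  ultimately show ?thesis by blast
qed

lemma weighted_sqnorm_measurable:
  fixes f :: "real \<Rightarrow> real"
  assumes "f \<in> borel_measurable (lebesgue_on {-1<..<1})"
  shows "(\<lambda>x. (1 - x\<^sup>2) ^ j * \<bar>f x\<bar>\<^sup>2) \<in> borel_measurable (lebesgue_on {-1<..<1})"
proof -
  have "(\<lambda>x. (1 - x\<^sup>2) ^ j) \<in> borel_measurable (lebesgue_on {-1<..<1::real})"
    by (intro continuous_imp_measurable_on_sets_lebesgue continuous_intros) auto
  from borel_measurable_times[OF this borel_measurable_power[OF assms, of 2]]
  show ?thesis by simp
qed

lemma weighted_sqnorm_measurable_indicator: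
  fixes f :: "real \<Rightarrow> real"
  assumes "f \<in> borel_measurable (lebesgue_on {-1<..<1})"
  shows "(\<lambda>x. ennreal ((1 - x\<^sup>2) ^ j * \<bar>f x\<bar>\<^sup>2) * indicator {-1<..<1} x) \<in> borel_measurable lebesgue"
proof -
  have "(\<lambda>x. ennreal ((1 - x\<^sup>2) ^ j * \<bar>f x\<bar>\<^sup>2)) \<in> borel_measurable (lebesgue_on {-1<..<1})"
    using weighted_sqnorm_measurable[OF assms] by measurable
  then show ?thesis by (subst (asm) borel_measurable_restrict_space_iff_ennreal) auto
qed

text \<open>The minimum over an interval of length 1 is at most the integral over it.\<close>

lemma weighted_sqnorm_small_value:
  assumes f: "f \<in> AC_loc0" and le: "weighted_sqnorm j f \<le> ennreal N" and "0 \<le> N"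
  shows "\<exists>y\<in>{-1/2..1/2}. (1 - y\<^sup>2) ^ j * (f y)\<^sup>2 \<le> N"
proof -
  let ?g = "\<lambda>x. (1 - x\<^sup>2) ^ j * (f x)\<^sup>2"
  have sub: "{-1/2..1/2} \<subseteq> {-1<..<1::real}" by auto
  have "continuous_on {-1/2..1/2} ?g"
    by (intro continuous_intros continuous_on_subset[OF AC_loc0_continuous_on[OF f] sub])
  then obtain y where y: "y \<in> {-1/2..1/2}" "\<And>x. x \<in> {-1/2..1/2} \<Longrightarrow> ?g y \<le> ?g x"
    using continuous_attains_inf[of "{-1/2..1/2::real}" ?g] by auto
  have "ennreal (?g y) = (\<integral>\<^sup>+x\<in>{-1/2..1/2::real}. ennreal (?g y) \<partial>lebesgue)"
    by (simp add: nn_integral_cmult_indicator)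
  also have "\<dots> \<le> weighted_sqnorm j f"
    unfolding weighted_sqnorm_def using y(2) sub
    by (intro nn_integral_mono) (auto simp: indicator_def intro!: ennreal_leI)
  finally have "ennreal (?g y) \<le> ennreal N" using le by (rule order_trans)
  then show ?thesis using y(1) \<open>0 \<le> N\<close> by (auto simp: ennreal_le_iff)
qed

text \<open>Off a null set, \<open>s\<close> times the derivative of the weighted square is at most
  \<open>2 * (i + 2) * \<phi>\<close>, and \<open>\<phi>\<close> has integral at most
  \<open>2 * N\<close>. The condition on \<open>s * t\<close> keeps away from the end point where
  the derivative of the weight has the wrong sign.\<close>

lemma weighted_square_increment:
  assumes f: "f \<in> AC_loc0"
    and le: "weighted_sqnorm (Suc i) f \<le> ennreal N" "weighted_sqnorm (Suc (Suc i)) (deriv f) \<le> ennreal N" and N: "0 \<le> N"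
    and ab: "-1 < a" "a \<le> b" "b < 1"
    and s: "s = 1 \<or> s = -1" "\<And>t. t \<in> {a..b} \<Longrightarrow> -1/2 \<le> s * t"
  shows "s * ((1 - b\<^sup>2) ^ Suc i * (f b)\<^sup>2 - (1 - a\<^sup>2) ^ Suc i * (f a)\<^sup>2) \<le> 4 * (i + 2) * N"
proof -
  \<comment> \<open>The weight is written with constants, sums, products and powers only, to match
    the closure rules of \<open>AC_loc0\<close>.\<close>
  define g where "g = (\<lambda>x. (1 + (-1) * x ^ 2) ^ Suc i * (f x)\<^sup>2)"
  define Z where "Z = {x \<in> {-1<..<1}. \<not> f differentiable (at x)}"
  define \<phi> where "\<phi> = (\<lambda>x. (1 - x\<^sup>2) ^ Suc i * \<bar>f x\<bar>\<^sup>2 + (1 - x\<^sup>2) ^ Suc (Suc i) * \<bar>deriv f x\<bar>\<^sup>2)"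
  have "g \<in> AC_loc0"
    unfolding g_def
    by (intro AC_loc0_mult AC_loc0_power AC_loc0_add AC_loc0_const AC_loc0_ident f)
  then have "(deriv g has_integral (g b - g a)) {a..b}"
    using ab by (intro AC_loc0_has_integral)
  then have "((\<lambda>x. s * deriv g x) has_integral s * (g b - g a)) {a..b}"
    by (rule has_integral_mult_right)
  moreover have Z: "negligible Z"
    unfolding Z_def by (rule AC_loc0_negligible_not_differentiable[OF f])
  \<comment> \<open>On \<open>Z\<close> the value of \<open>deriv g\<close> is unknown; replacing it
    by 0 leaves the integral unchanged and makes the pointwise bound hold everywhere.\<close>
  ultimately have int: "((\<lambda>x. if x \<in> Z then 0 else s * deriv g x) has_integral s * (g b - g a)) {a..b}"
    by (elim has_integral_spike[rotated 2]) auto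
  have meas: "f \<in> borel_measurable (lebesgue_on {-1<..<1})" "deriv f \<in> borel_measurable (lebesgue_on {-1<..<1})"
    using f by (auto intro: AC_loc0_measurable AC_loc0_deriv_measurable)
  have \<phi>_nonneg: "0 \<le> \<phi> x" if "x \<in> {-1<..<1}" for x
    using weight_pos[OF that] unfolding \<phi>_def by (intro add_nonneg_nonneg mult_nonneg_nonneg) auto
  have "(\<integral>\<^sup>+x\<in>{-1<..<1}. ennreal (\<phi> x) \<partial>lebesgue) = weighted_sqnorm (Suc i) f + weighted_sqnorm (Suc (Suc i)) (deriv f)"
    unfolding weighted_sqnorm_def
  proof (subst nn_integral_add[symmetric])
    show "(\<integral>\<^sup>+x\<in>{-1<..<1}. ennreal (\<phi> x) \<partial>lebesgue) =
        (\<integral>\<^sup>+x. ennreal ((1 - x\<^sup>2) ^ Suc i * \<bar>f x\<bar>\<^sup>2) * indicator {-1<..<1} x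
          + ennreal ((1 - x\<^sup>2) ^ Suc (Suc i) * \<bar>deriv f x\<bar>\<^sup>2) * indicator {-1<..<1} x \<partial>lebesgue)"
    proof (intro nn_integral_cong)
      fix x :: real
      show "ennreal (\<phi> x) * indicator {-1<..<1} x = ennreal ((1 - x\<^sup>2) ^ Suc i * \<bar>f x\<bar>\<^sup>2) * indicator {-1<..<1} x
          + ennreal ((1 - x\<^sup>2) ^ Suc (Suc i) * \<bar>deriv f x\<bar>\<^sup>2) * indicator {-1<..<1} x"
      proof (cases "x \<in> {-1<..<1}")
        case True
        then have "0 \<le> (1 - x\<^sup>2) ^ Suc i * \<bar>f x\<bar>\<^sup>2" "0 \<le> (1 - x\<^sup>2) ^ Suc (Suc i) * \<bar>deriv f x\<bar>\<^sup>2"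
          using weight_pos[OF True] by (auto intro!: mult_nonneg_nonneg)
        then show ?thesis using True unfolding \<phi>_def by (simp del: power_Suc add: ennreal_plus)
      qed simp
    qed
  qed (intro weighted_sqnorm_measurable_indicator meas)+
  also have "\<dots> \<le> ennreal N + ennreal N" using le by (rule add_mono)
  also have "\<dots> = ennreal (2 * N)" using N by (simp flip: ennreal_plus)
  finally have "\<exists>I. (\<phi> has_integral I) {a..b} \<and> I \<le> 2 * N"
    using N ab \<phi>_nonneg unfolding \<phi>_def
    by (intro integral_le_nn_integral[where S = "{-1<..<1}"] borel_measurable_add weighted_sqnorm_measurable meas) auto
  then obtain I where I: "(\<phi> has_integral I) {a..b}" "I \<le> 2 * N" by blast
  have "((\<lambda>x. 2 * (i + 2) * \<phi> x) has_integral 2 * (i + 2) * I) {a..b}"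
    using I(1) by (rule has_integral_mult_right)
  with int have "s * (g b - g a) \<le> 2 * (i + 2) * I"
  proof (rule has_integral_le)
    fix x assume x: "x \<in> {a..b}"
    then have xI: "x \<in> {-1<..<1}" using ab by auto
    show "(if x \<in> Z then 0 else s * deriv g x) \<le> 2 * (i + 2) * \<phi> x"
    proof (cases "x \<in> Z")
      case True
      then show ?thesis using \<phi>_nonneg[OF xI] by simp
    next
      case False
      then have D: "(f has_real_derivative deriv f x) (at x)"
        using xI by (simp add: Z_def DERIV_deriv_iff_real_differentiable)
      have "(g has_real_derivative (1 - x\<^sup>2) ^ i *
          (2 * (1 - x\<^sup>2) * f x * deriv f x - 2 * (1 + real i) * x * (f x)\<^sup>2)) (at x)"
        unfolding g_def
        by (rule derivative_eq_intros D refl)+ (simp add: algebra_simps power2_eq_square)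
      then have "s * deriv g x = (1 - x\<^sup>2) ^ i *
          (s * (2 * (1 - x\<^sup>2) * f x * deriv f x - 2 * (1 + real i) * x * (f x)\<^sup>2))"
        by (simp add: DERIV_imp_deriv)
      also have "\<dots> \<le> (1 - x\<^sup>2) ^ i *
          (2 * ((1 + real i) + 1) * ((1 - x\<^sup>2) * (f x)\<^sup>2 + (1 - x\<^sup>2)\<^sup>2 * (deriv f x)\<^sup>2))"
        using weight_pos[OF xI] xI s x by (intro mult_left_mono weight_increment_bound) auto
      also have "\<dots> = 2 * (i + 2) * \<phi> x"
        by (simp add: \<phi>_def algebra_simps power2_eq_square)
      finally show ?thesis using False by simp
    qed
  qed
  also have "2 * (i + 2) * I \<le> 2 * (i + 2) * (2 * N)" using I(2) by (intro mult_left_mono) auto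
  also have "\<dots> = 4 * (i + 2) * N" by (simp add: algebra_simps)
  finally show ?thesis by (simp add: g_def)
qed

text \<open>Start from a point \<open>y\<close> of \<open>[-1/2, 1/2]\<close> with small weighted
  square and move to \<open>x\<close>, with \<open>s = 1\<close> to the right and
  \<open>s = -1\<close> to the left. Since \<open>y\<close> is in the middle half,
  \<open>s * t\<close> stays above -1/2 on the way.\<close>

lemma weighted_square_bound:
  assumes f: "f \<in> AC_loc0"
    and le: "weighted_sqnorm (Suc i) f \<le> ennreal N" "weighted_sqnorm (Suc (Suc i)) (deriv f) \<le> ennreal N" and N: "0 \<le> N"
    and x: "x \<in> {-1<..<1}"
  shows "(1 - x\<^sup>2) ^ Suc i * (f x)\<^sup>2 \<le> (1 + 4 * (i + 2)) * N"
proof -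
  let ?g = "\<lambda>x. (1 - x\<^sup>2) ^ Suc i * (f x)\<^sup>2"
  obtain y where y: "y \<in> {-1/2..1/2}" "?g y \<le> N" using weighted_sqnorm_small_value[OF f le(1) N] by blast
  have "?g x - ?g y \<le> 4 * (i + 2) * N"
  proof (cases "y \<le> x")
    case True
    show ?thesis
      using weighted_square_increment[OF f le N, of y x 1] True x y(1) by auto
  next
    case False
    show ?thesis
      using weighted_square_increment[OF f le N, of x y "-1"] False x y(1) by auto
  qed
  then show ?thesis using y(2) by (simp add: algebra_simps)
qed

text \<open>The hypothesis bounds the derivative of \<open>f\<close> by that of
  \<open>K * arcsin\<close>, so adding or subtracting \<open>f\<close> leaves a nondecreasing
  function. This makes the integrability of the weight to the power -1/2 explicit.\<close>

lemma increment_le_arcsin: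
  assumes diff: "\<And>x. x \<in> {-1<..<1} \<Longrightarrow> f differentiable (at x)"
    and bound: "\<And>x. x \<in> {-1<..<1} \<Longrightarrow> (1 - x\<^sup>2) * (deriv f x)\<^sup>2 \<le> K\<^sup>2" and K: "0 \<le> K"
    and ab: "-1 < a" "a \<le> b" "b < 1"
  shows "\<bar>f b - f a\<bar> \<le> K * (arcsin b - arcsin a)"
proof -
  have le: "\<bar>deriv f x\<bar> \<le> K * inverse (sqrt (1 - x\<^sup>2))" if x: "x \<in> {-1<..<1}" for x
  proof -
    have "(sqrt (1 - x\<^sup>2) * \<bar>deriv f x\<bar>)\<^sup>2 \<le> K\<^sup>2"
      using bound[OF x] weight_pos[OF x] by (simp add: power_mult_distrib)
    then have "sqrt (1 - x\<^sup>2) * \<bar>deriv f x\<bar> \<le> K" using K by (rule power2_le_imp_le)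
    then show ?thesis using weight_pos[OF x] by (simp add: field_simps)
  qed
  have mono: "K * arcsin a + s * f a \<le> K * arcsin b + s * f b" if s: "s = 1 \<or> s = -1" for s
  proof (rule DERIV_nonneg_imp_nondecreasing[OF ab(2)])
    fix x assume "a \<le> x" "x \<le> b"
    then have x: "x \<in> {-1<..<1}" using ab by auto
    have D: "(f has_real_derivative deriv f x) (at x)"
      using diff[OF x] by (simp add: DERIV_deriv_iff_real_differentiable)
    have "((\<lambda>x. K * arcsin x + s * f x) has_real_derivative
        K * inverse (sqrt (1 - x\<^sup>2)) + s * deriv f x) (at x)"
      using x by (intro DERIV_add DERIV_cmult DERIV_arcsin D) auto
    moreover have "0 \<le> K * inverse (sqrt (1 - x\<^sup>2)) + s * deriv f x" using le[OF x] s by auto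
    ultimately show "\<exists>y. ((\<lambda>x. K * arcsin x + s * f x) has_real_derivative y) (at x) \<and> 0 \<le> y"
      by blast
  qed
  show ?thesis using mono[of 1] mono[of "-1"] by (simp add: right_diff_distrib abs_le_iff)
qed

text \<open>The arcsine varies by at most \<open>pi\<close>, so \<open>f\<close> differs by at most
  \<open>pi * sqrt (M * N)\<close> from its value at a point where its square is at most
  \<open>N\<close>.\<close>

lemma square_bound_of_deriv_bound:
  assumes f: "f \<in> AC_loc0" and diff: "\<And>x. x \<in> {-1<..<1} \<Longrightarrow> f differentiable (at x)"
    and le: "weighted_sqnorm 0 f \<le> ennreal N" and N: "0 \<le> N" "0 \<le> M"
    and bound: "\<And>x. x \<in> {-1<..<1} \<Longrightarrow> (1 - x\<^sup>2) * (deriv f x)\<^sup>2 \<le> M * N"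
    and x: "x \<in> {-1<..<1}"
  shows "(f x)\<^sup>2 \<le> (1 + pi * sqrt M)\<^sup>2 * N"
proof -
  define K where "K = sqrt M * sqrt N"
  have K: "0 \<le> K" "K\<^sup>2 = M * N" using N by (auto simp: K_def power_mult_distrib)
  obtain y where y: "y \<in> {-1/2..1/2}" "(f y)\<^sup>2 \<le> N" using weighted_sqnorm_small_value[OF f le N(1)] by auto
  have yI: "y \<in> {-1<..<1}" using y by auto
  have arcsin: "- (pi/2) \<le> arcsin z \<and> arcsin z \<le> pi/2" if "z \<in> {-1<..<1}" for z
    using that arcsin_bounded by auto
  have "\<bar>f x - f y\<bar> \<le> K * pi"
  proof (cases "y \<le> x")
    case True
    have "\<bar>f x - f y\<bar> \<le> K * (arcsin x - arcsin y)"
      using True x yI K bound by (intro increment_le_arcsin diff) auto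
    also have "\<dots> \<le> K * pi" using K arcsin[OF x] arcsin[OF yI] by (intro mult_left_mono) auto
    finally show ?thesis .
  next
    case False
    have "\<bar>f y - f x\<bar> \<le> K * (arcsin y - arcsin x)"
      using False x yI K bound by (intro increment_le_arcsin diff) auto
    also have "\<dots> \<le> K * pi" using K arcsin[OF x] arcsin[OF yI] by (intro mult_left_mono) auto
    finally show ?thesis by (simp add: abs_minus_commute)
  qed
  moreover have "\<bar>f y\<bar> \<le> sqrt N" using y(2) by (simp add: real_le_rsqrt)
  ultimately have "\<bar>f x\<bar> \<le> (1 + pi * sqrt M) * sqrt N" unfolding K_def by (simp add: algebra_simps)
  then have "\<bar>f x\<bar>\<^sup>2 \<le> ((1 + pi * sqrt M) * sqrt N)\<^sup>2" by (intro power_mono) auto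
  then show ?thesis using N by (simp add: power_mult_distrib)
qed

subsection \<open>The algebra property\<close>

text \<open>The weight \<open>w ^ m\<close> splits as \<open>w ^ i * w ^ (m - i)\<close>, and at
  least one of the orders \<open>i\<close> and \<open>m - i\<close> is below \<open>k\<close>. That
  factor is bounded by \<open>A\<close> or \<open>B\<close>, and the other by the corresponding full
  sum.\<close>

lemma Leibniz_square_bound:
  fixes a b :: "nat \<Rightarrow> real"
  assumes w: "0 \<le> w" and AB: "0 \<le> A" "0 \<le> B"
    and a: "\<And>j. j < k \<Longrightarrow> w ^ j * (a j)\<^sup>2 \<le> A" and b: "\<And>j. j < k \<Longrightarrow> w ^ j * (b j)\<^sup>2 \<le> B"
    and mk: "m \<le> k" "1 \<le> k"
  shows "w ^ m * (\<Sum>i\<le>m. of_nat (m choose i) * (a i * b (m - i)))\<^sup>2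
    \<le> (real k + 1)\<^sup>2 * 4 ^ k * (A * (\<Sum>j\<le>k. w ^ j * (b j)\<^sup>2) + B * (\<Sum>j\<le>k. w ^ j * (a j)\<^sup>2))"
    (is "_ \<le> _ * ?R")
proof -
  let ?Sa = "\<Sum>j\<le>k. w ^ j * (a j)\<^sup>2" and ?Sb = "\<Sum>j\<le>k. w ^ j * (b j)\<^sup>2"
  have S: "w ^ j * (a j)\<^sup>2 \<le> ?Sa" "w ^ j * (b j)\<^sup>2 \<le> ?Sb" if "j \<le> k" for j
    using that w by (auto intro!: member_le_sum)
  have S0: "0 \<le> ?Sa" "0 \<le> ?Sb" using w by (auto intro!: sum_nonneg)
  have R: "w ^ m * (a i * b (m - i))\<^sup>2 \<le> ?R" if "i \<le> m" for i
  proof -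
    have "w ^ m = w ^ i * w ^ (m - i)" using that by (simp flip: power_add)
    then have eq: "w ^ m * (a i * b (m - i))\<^sup>2 = (w ^ i * (a i)\<^sup>2) * (w ^ (m - i) * (b (m - i))\<^sup>2)"
      by (simp add: power_mult_distrib)
    show ?thesis
    proof (cases "i < k")
      case True
      have "w ^ m * (a i * b (m - i))\<^sup>2 \<le> A * ?Sb"
        unfolding eq using True w AB mk by (intro mult_mono a S) auto
      then show ?thesis using S0 AB by (simp add: add_increasing2)
    next
      case False
      \<comment> \<open>Here \<open>i = m = k\<close>, so the other order is 0.\<close>
      then have "m - i < k" "i \<le> k" using that mk by auto
      then have "w ^ m * (a i * b (m - i))\<^sup>2 \<le> ?Sa * B"
        unfolding eq using w S0 by (intro mult_mono b S) auto
      then show ?thesis using S0 AB by (simp add: add_increasing mult.commute)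
    qed
  qed
  have R0: "0 \<le> ?R" using S0 AB by simp
  \<comment> \<open>One factor \<open>m + 1\<close> comes from the Cauchy-Schwarz inequality,
    another from the number of terms, and \<open>4 ^ k\<close> from the squared binomial
    coefficients.\<close>
  have "w ^ m * (\<Sum>i\<le>m. of_nat (m choose i) * (a i * b (m - i)))\<^sup>2
      \<le> w ^ m * ((\<Sum>i\<le>m. (of_nat (m choose i) * (a i * b (m - i)))\<^sup>2) * card {..m})"
    using w by (intro mult_left_mono sum_squared_le_sum_of_squares) auto
  also have "\<dots> = (\<Sum>i\<le>m. (of_nat (m choose i))\<^sup>2 * (w ^ m * (a i * b (m - i))\<^sup>2)) * (m + 1)"
    by (simp add: sum_distrib_left sum_distrib_right power_mult_distrib mult_ac)
  also have "\<dots> \<le> (\<Sum>i\<le>m. 4 ^ k * ?R) * (m + 1)"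
  proof (intro mult_right_mono sum_mono mult_mono R)
    fix i
    have "real (m choose i) \<le> 2 ^ m" using binomial_le_pow2[of m i] by (simp flip: of_nat_le_iff)
    then have "(real (m choose i))\<^sup>2 \<le> (2 ^ m)\<^sup>2" by (rule power_mono) simp
    also have "\<dots> = 4 ^ m" by (simp add: power2_eq_square flip: power_mult_distrib)
    also have "\<dots> \<le> (4 :: real) ^ k" using mk by (intro power_increasing) auto
    finally show "(real (m choose i))\<^sup>2 \<le> 4 ^ k" .
  qed (use w in auto)
  also have "\<dots> = (real m + 1)\<^sup>2 * (4 ^ k * ?R)" by (simp add: power2_eq_square algebra_simps)
  also have "\<dots> \<le> (real k + 1)\<^sup>2 * (4 ^ k * ?R)"
    using mk R0 by (intro mult_right_mono power_mono) auto
  finally show ?thesis by (simp add: mult.assoc)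
qed

section \<open>Pointwise bounds for members of the space\<close>

lemma H_spaceD:
  assumes "u \<in> H_space k" "1 \<le> k"
  shows "u \<in> AC_loc (k - 1)" "H_sqnorm k u = ennreal (enn2real (H_sqnorm k u))"
    and "\<And>j. j \<le> k \<Longrightarrow> weighted_sqnorm j ((deriv ^^ j) u) \<le> ennreal (enn2real (H_sqnorm k u))"
    and "\<And>j. j \<le> k \<Longrightarrow> (deriv ^^ j) u \<in> borel_measurable (lebesgue_on {-1<..<1})"
proof -
  show AC: "u \<in> AC_loc (k - 1)" using assms by (simp add: H_space_def)
  show eq: "H_sqnorm k u = ennreal (enn2real (H_sqnorm k u))"
    using assms by (simp add: H_space_def)
  show "weighted_sqnorm j ((deriv ^^ j) u) \<le> ennreal (enn2real (H_sqnorm k u))" if "j \<le> k" for j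
    unfolding eq[symmetric] unfolding H_sqnorm_eq_weighted_sqnorm using that by (intro member_le_sum) auto
  show "(deriv ^^ j) u \<in> borel_measurable (lebesgue_on {-1<..<1})" if "j \<le> k" for j
  proof (cases "j = k")
    case True
    then obtain i where i: "j = Suc i" "i \<le> k - 1" using assms(2) by (cases j) auto
    then have "deriv ((deriv ^^ i) u) \<in> borel_measurable (lebesgue_on {-1<..<1})"
      using AC by (intro AC_loc0_deriv_measurable) (auto simp: AC_loc_iff)
    then show ?thesis by (simp add: i)
  next
    case False
    then show ?thesis using AC that by (intro AC_loc0_measurable) (auto simp: AC_loc_iff)
  qed
qed

text \<open>The first summand is the constant for positive orders, the second the one for order 0;
  their sum serves both.\<close>

definition pointwise_const :: "nat \<Rightarrow> real" where
  "pointwise_const k = (1 + 4 * k) + (1 + pi * sqrt (1 + 4 * k))\<^sup>2"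

text \<open>Order 0 is reduced to order 1, whose bound requires \<open>1 < k\<close>; the same
  condition makes \<open>u\<close> differentiable at every point of the interval.\<close>

lemma H_space_pointwise:
  assumes u: "u \<in> H_space k" and "2 \<le> k" "j < k" and x: "x \<in> {-1<..<1}"
  shows "(1 - x\<^sup>2) ^ j * ((deriv ^^ j) u x)\<^sup>2 \<le> pointwise_const k * enn2real (H_sqnorm k u)"
proof -
  define N where "N = enn2real (H_sqnorm k u)"
  have N: "0 \<le> N" by (simp add: N_def)
  have "1 \<le> k" using \<open>2 \<le> k\<close> by simp
  note D = H_spaceD[OF u \<open>1 \<le> k\<close>, folded N_def]
  have AC: "(deriv ^^ i) u \<in> AC_loc0" if "i < k" for i
    using D(1) that by (auto simp: AC_loc_iff)
  have pos: "(1 - y\<^sup>2) ^ Suc i * ((deriv ^^ Suc i) u y)\<^sup>2 \<le> (1 + 4 * k) * N"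
    if i: "Suc i < k" and y: "y \<in> {-1<..<1}" for i y
  proof -
    have "(1 - y\<^sup>2) ^ Suc i * ((deriv ^^ Suc i) u y)\<^sup>2 \<le> (1 + 4 * (i + 2)) * N"
      using D(3)[of "Suc i"] D(3)[of "Suc (Suc i)"] i y N
      by (intro weighted_square_bound AC) auto
    also have "\<dots> \<le> (1 + 4 * k) * N" using i N by (intro mult_right_mono) auto
    finally show ?thesis .
  qed
  have "(1 - x\<^sup>2) ^ j * ((deriv ^^ j) u x)\<^sup>2 \<le> pointwise_const k * N"
  proof (cases j)
    case 0
    have "(u x)\<^sup>2 \<le> (1 + pi * sqrt (1 + 4 * k))\<^sup>2 * N"
    proof (rule square_bound_of_deriv_bound[OF _ _ _ N _ _ x])
      show "u \<in> AC_loc0" using AC[of 0] \<open>2 \<le> k\<close> by simp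
      show "u differentiable (at y)" if "y \<in> {-1<..<1}" for y
        using D(1) \<open>2 \<le> k\<close> that by (auto simp: AC_loc_iff dest!: spec[of _ "0::nat"])
      show "weighted_sqnorm 0 u \<le> ennreal N" using D(3)[of 0] by simp
      show "(1 - y\<^sup>2) * (deriv u y)\<^sup>2 \<le> (1 + 4 * k) * N" if "y \<in> {-1<..<1}" for y
        using pos[of 0 y] \<open>2 \<le> k\<close> that by simp
    qed simp
    also have "\<dots> \<le> pointwise_const k * N"
      unfolding pointwise_const_def using N by (intro mult_right_mono) auto
    finally show ?thesis using 0 by simp
  next
    case (Suc i)
    have "(1 - x\<^sup>2) ^ j * ((deriv ^^ j) u x)\<^sup>2 \<le> (1 + 4 * k) * N"
      using pos[of i x] Suc \<open>j < k\<close> x by simp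
    also have "\<dots> \<le> pointwise_const k * N"
      unfolding pointwise_const_def using N by (intro mult_right_mono) auto
    finally show ?thesis .
  qed
  then show ?thesis by (simp add: N_def)
qed

section \<open>Integrating the Leibniz bound\<close>

definition H_density :: "nat \<Rightarrow> (real \<Rightarrow> real) \<Rightarrow> real \<Rightarrow> real" where
  "H_density k u x = (\<Sum>j\<le>k. (1 - x\<^sup>2) ^ j * \<bar>(deriv ^^ j) u x\<bar>\<^sup>2)"

lemma H_density_nonneg: "x \<in> {-1<..<1} \<Longrightarrow> 0 \<le> H_density k u x"
  unfolding H_density_def using weight_pos[of x] by (intro sum_nonneg) auto

lemma H_density_measurable:
  assumes "u \<in> H_space k" "1 \<le> k"
  shows "(\<lambda>x. ennreal (H_density k u x) * indicator {-1<..<1} x) \<in> borel_measurable lebesgue"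
proof -
  have "H_density k u \<in> borel_measurable (lebesgue_on {-1<..<1})"
    unfolding H_density_def using H_spaceD(4)[OF assms]
    by (intro borel_measurable_sum weighted_sqnorm_measurable) auto
  then have "(\<lambda>x. ennreal (H_density k u x)) \<in> borel_measurable (lebesgue_on {-1<..<1})" by measurable
  then show ?thesis by (subst (asm) borel_measurable_restrict_space_iff_ennreal) auto
qed

lemma nn_integral_H_density:
  assumes "u \<in> H_space k" "1 \<le> k"
  shows "(\<integral>\<^sup>+x\<in>{-1<..<1}. ennreal (H_density k u x) \<partial>lebesgue) = H_sqnorm k u"
proof -
  have "(\<integral>\<^sup>+x\<in>{-1<..<1}. ennreal (H_density k u x) \<partial>lebesgue) =
    (\<integral>\<^sup>+x. (\<Sum>j\<le>k. ennreal ((1 - x\<^sup>2) ^ j * \<bar>(deriv ^^ j) u x\<bar>\<^sup>2) * indicator {-1<..<1} x) \<partial>lebesgue)"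
  proof (intro nn_integral_cong)
    fix x :: real
    show "ennreal (H_density k u x) * indicator {-1<..<1} x =
      (\<Sum>j\<le>k. ennreal ((1 - x\<^sup>2) ^ j * \<bar>(deriv ^^ j) u x\<bar>\<^sup>2) * indicator {-1<..<1} x)"
    proof (cases "x \<in> {-1<..<1}")
      case True
      then show ?thesis using weight_pos[OF True]
        by (simp add: H_density_def sum_ennreal)
    qed simp
  qed
  also have "\<dots> = H_sqnorm k u"
    unfolding H_sqnorm_def using H_spaceD(4)[OF assms]
    by (intro nn_integral_sum weighted_sqnorm_measurable_indicator) auto
  finally show ?thesis .
qed

text \<open>Up to order \<open>m\<close> the formula holds everywhere. At order \<open>Suc m\<close>
  it holds off the null set where the derivative of order \<open>m\<close> of \<open>u\<close> or
  \<open>v\<close> is not differentiable.\<close>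

lemma AE_Leibniz:
  assumes u: "u \<in> AC_loc m" and v: "v \<in> AC_loc m"
  shows "AE x in lebesgue. x \<in> {-1<..<1} \<longrightarrow> (\<forall>j\<le>Suc m. (deriv ^^ j) (\<lambda>x. u x * v x) x =
      (\<Sum>i\<le>j. of_nat (j choose i) * ((deriv ^^ i) u x * (deriv ^^ (j - i)) v x)))"
proof (rule AE_I')
  let ?Z = "\<lambda>f. {x \<in> {-1<..<1}. \<not> (deriv ^^ m) f differentiable (at x)}"
  have "negligible (?Z u \<union> ?Z v)"
    using u v by (intro negligible_Un AC_loc0_negligible_not_differentiable) (auto simp: AC_loc_iff)
  then show "?Z u \<union> ?Z v \<in> null_sets lebesgue" by (simp add: negligible_iff_null_sets)
  have "(deriv ^^ j) (\<lambda>x. u x * v x) x =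
      (\<Sum>i\<le>j. of_nat (j choose i) * ((deriv ^^ i) u x * (deriv ^^ (j - i)) v x))"
    if x: "x \<in> {-1<..<1}" "x \<notin> ?Z u \<union> ?Z v" and j: "j \<le> Suc m" for x j
  proof (cases "j = Suc m")
    case True
    have "(deriv ^^ i) u differentiable (at x)" "(deriv ^^ i) v differentiable (at x)" if "i \<le> m" for i
      using that x u v by (cases "i = m"; auto simp: AC_loc_iff)+
    then show ?thesis
      unfolding True using x u v by (intro Leibniz_step(2) Leibniz_AC_loc) auto
  next
    case False
    then show ?thesis using j x by (intro Leibniz_AC_loc[OF u v]) auto
  qed
  then show "{x \<in> space lebesgue. \<not> (x \<in> {-1<..<1} \<longrightarrow> (\<forall>j\<le>Suc m. (deriv ^^ j) (\<lambda>x. u x * v x) x =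
      (\<Sum>i\<le>j. of_nat (j choose i) * ((deriv ^^ i) u x * (deriv ^^ (j - i)) v x))))} \<subseteq> ?Z u \<union> ?Z v"
    by blast
qed

text \<open>Integrating the pointwise bound gives \<open>2 * Q * (Nu * Nv)\<close> for each order,
  where \<open>Q\<close> contains the square of \<open>real k + 1\<close>. Summing over the
  \<open>k + 1\<close> orders produces the cube.\<close>

lemma H_sqnorm_mult_le:
  assumes k: "2 \<le> k" and u: "u \<in> H_space k" and v: "v \<in> H_space k"
  shows "H_sqnorm k (\<lambda>x. u x * v x) \<le> ennreal (2 * (real k + 1) ^ 3 * 4 ^ k * pointwise_const k *
    (enn2real (H_sqnorm k u) * enn2real (H_sqnorm k v)))"
proof -
  define Nu where "Nu = enn2real (H_sqnorm k u)"
  define Nv where "Nv = enn2real (H_sqnorm k v)"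
  define M where "M = pointwise_const k"
  define Q where "Q = (real k + 1)\<^sup>2 * 4 ^ k * M"
  have nn: "0 \<le> Nu" "0 \<le> Nv" "0 \<le> M" by (auto simp: Nu_def Nv_def M_def pointwise_const_def)
  then have Q: "0 \<le> Q" by (simp add: Q_def)
  have k1: "1 \<le> k" "Suc (k - 1) = k" using k by auto
  have AE: "AE x in lebesgue. x \<in> {-1<..<1} \<longrightarrow> (\<forall>j\<le>k. (deriv ^^ j) (\<lambda>x. u x * v x) x =
      (\<Sum>i\<le>j. of_nat (j choose i) * ((deriv ^^ i) u x * (deriv ^^ (j - i)) v x)))"
    using AE_Leibniz[OF H_spaceD(1)[OF u k1(1)] H_spaceD(1)[OF v k1(1)]] unfolding k1(2) .
  have summand: "weighted_sqnorm m ((deriv ^^ m) (\<lambda>x. u x * v x)) \<le> ennreal (2 * Q * (Nu * Nv))" if m: "m \<le> k" for m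
  proof -
    have "weighted_sqnorm m ((deriv ^^ m) (\<lambda>x. u x * v x)) \<le>
      (\<integral>\<^sup>+x. ennreal (Q * Nu) * (ennreal (H_density k v x) * indicator {-1<..<1} x)
        + ennreal (Q * Nv) * (ennreal (H_density k u x) * indicator {-1<..<1} x) \<partial>lebesgue)"
      unfolding weighted_sqnorm_def
    proof (rule nn_integral_mono_AE, rule AE_mp[OF AE], intro AE_I2 impI)
      fix x :: real
      assume L: "x \<in> {-1<..<1} \<longrightarrow> (\<forall>j\<le>k. (deriv ^^ j) (\<lambda>x. u x * v x) x =
          (\<Sum>i\<le>j. of_nat (j choose i) * ((deriv ^^ i) u x * (deriv ^^ (j - i)) v x)))"
      show "ennreal ((1 - x\<^sup>2) ^ m * \<bar>(deriv ^^ m) (\<lambda>x. u x * v x) x\<bar>\<^sup>2) * indicator {-1<..<1} x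
        \<le> ennreal (Q * Nu) * (ennreal (H_density k v x) * indicator {-1<..<1} x)
          + ennreal (Q * Nv) * (ennreal (H_density k u x) * indicator {-1<..<1} x)"
      proof (cases "x \<in> {-1<..<1}")
        case True
        have "(1 - x\<^sup>2) ^ m * \<bar>(deriv ^^ m) (\<lambda>x. u x * v x) x\<bar>\<^sup>2 = (1 - x\<^sup>2) ^ m *
            (\<Sum>i\<le>m. of_nat (m choose i) * ((deriv ^^ i) u x * (deriv ^^ (m - i)) v x))\<^sup>2"
          using L True m by simp
        also have "\<dots> \<le> (real k + 1)\<^sup>2 * 4 ^ k * (M * Nu * H_density k v x + M * Nv * H_density k u x)"
          unfolding H_density_def power2_abs
          using weight_pos[OF True] nn m k1 True k u v unfolding M_def Nu_def Nv_def
          by (intro Leibniz_square_bound H_space_pointwise) auto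
        also have "\<dots> = Q * Nu * H_density k v x + Q * Nv * H_density k u x"
          by (simp add: Q_def algebra_simps)
        finally have "ennreal ((1 - x\<^sup>2) ^ m * \<bar>(deriv ^^ m) (\<lambda>x. u x * v x) x\<bar>\<^sup>2) \<le>
            ennreal (Q * Nu * H_density k v x + Q * Nv * H_density k u x)"
          by (rule ennreal_leI)
        then show ?thesis
          using True Q nn H_density_nonneg[OF True] by (simp add: ennreal_mult ennreal_plus)
      qed simp
    qed
    also have "\<dots> = ennreal (Q * Nu) * H_sqnorm k v + ennreal (Q * Nv) * H_sqnorm k u"
      using H_density_measurable[OF u k1(1)] H_density_measurable[OF v k1(1)]
      by (simp add: nn_integral_add nn_integral_cmult nn_integral_H_density[OF u k1(1)]
          nn_integral_H_density[OF v k1(1)])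
    also have "\<dots> = ennreal (Q * Nu) * ennreal Nv + ennreal (Q * Nv) * ennreal Nu"
      using H_spaceD(2)[OF u k1(1)] H_spaceD(2)[OF v k1(1)] by (simp add: Nu_def Nv_def)
    also have "\<dots> = ennreal (Q * Nu * Nv + Q * Nv * Nu)"
      using Q nn by (simp only: ennreal_plus ennreal_mult mult_nonneg_nonneg)
    also have "Q * Nu * Nv + Q * Nv * Nu = 2 * Q * (Nu * Nv)" by (simp add: algebra_simps)
    finally show ?thesis .
  qed
  have "H_sqnorm k (\<lambda>x. u x * v x) \<le> (\<Sum>m\<le>k. ennreal (2 * Q * (Nu * Nv)))"
    unfolding H_sqnorm_eq_weighted_sqnorm by (intro sum_mono summand) auto
  also have "\<dots> = ennreal (\<Sum>m\<le>k. 2 * Q * (Nu * Nv))" using Q nn by (intro sum_ennreal) auto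
  also have "(\<Sum>m\<le>k. 2 * Q * (Nu * Nv)) = 2 * (real k + 1) ^ 3 * 4 ^ k * M * (Nu * Nv)"
    by (simp add: Q_def power2_eq_square power3_eq_cube algebra_simps)
  finally show ?thesis by (simp only: Nu_def Nv_def M_def)
qed

theorem theorem2p9:
  fixes k :: nat
  assumes "k \<ge> 2"
  shows "\<exists>C::real. C > 0 \<and>
    (\<forall>u\<in>H_space k. \<forall>v\<in>H_space k.
       (\<lambda>x. u x * v x) \<in> H_space k \<and>
       H_norm k (\<lambda>x. u x * v x) \<le> C * H_norm k u * H_norm k v)"
proof -
  define Q where "Q = 2 * (real k + 1) ^ 3 * 4 ^ k * pointwise_const k"
  have "0 < pointwise_const k" by (simp add: pointwise_const_def add_pos_nonneg)
  then have Q: "0 < Q" by (simp add: Q_def)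
  show ?thesis
  \<comment> \<open>\<open>Q\<close> bounds the squared norm, so its square root is the constant for
    the norm.\<close>
  proof (intro exI[of _ "sqrt Q"] conjI ballI)
    fix u v assume u: "u \<in> H_space k" and v: "v \<in> H_space k"
    let ?N = "\<lambda>u. enn2real (H_sqnorm k u)"
    have le: "H_sqnorm k (\<lambda>x. u x * v x) \<le> ennreal (Q * (?N u * ?N v))"
      using H_sqnorm_mult_le[OF assms u v] by (simp add: Q_def)
    then have fin: "H_sqnorm k (\<lambda>x. u x * v x) < \<infinity>"
      by (rule le_less_trans) simp
    show "(\<lambda>x. u x * v x) \<in> H_space k"
      using AC_loc_mult u v fin by (simp add: H_space_def)
    have "?N (\<lambda>x. u x * v x) \<le> Q * (?N u * ?N v)"
      using enn2real_mono[OF le] Q by simp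
    then have "sqrt (?N (\<lambda>x. u x * v x)) \<le> sqrt (Q * (?N u * ?N v))" by simp
    then show "H_norm k (\<lambda>x. u x * v x) \<le> sqrt Q * H_norm k u * H_norm k v"
      by (simp add: H_norm_def real_sqrt_mult mult.assoc)
  qed (use Q in simp)
qed

end
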